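(* Suppose $h$ is a conformal mapping in $W^{1,2}(\overline{\mathbb{R}}^2,\overline{\mathbb{R}}^2)$ with $\det\nabla h(\mathbf{x})>0$. Then there exists the conformal mapping $g:=g_1+g_2$ in $W^{1,2}(h(\overline{\mathbb{R}}^2),\overline{\mathbb{R}}^2)$ (with $g_1,g_2$ as in the context) determined by solving the Euler--Lagrange equations $$\Delta_{\mathbf{y}}g_1(\mathbf{y})=0,\qquad \Delta_{\hat{\mathbf{y}}}g_2(\hat{\mathbf{y}})=0 .$$ Furthermore, $g$ composed with $h$ is an equiareal (area-preserving) map, i.e. $g\circ h:(\overline{\mathbb{R}}^2,\delta)\to(g(\overline{\mathbb{R}}^2),\delta)$ satisfies $$\det\nabla (g\circ h)(\mathbf{x})=1,$$ where $\delta$ is the Euclidean metric in $\mathbb{R}^2$.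
   Context: $\overline{\mathbb{R}}^2=\mathbb{R}^2\cup\{\infty\}$, $\mathbb{D}$ is the unit disk in $\mathbb{R}^2$, and $\rho=\frac{4}{(u^2+v^2+1)^2}(du^2+dv^2)$. The map $h$ is of the form $h=\pi\circ f\circ\pi^{-1}$, where $\pi$ is the stereographic projection and $f:\mathcal{M}\to\mathbb{S}^2$ is a (conformal) map from a closed genus-zero surface $\mathcal{M}\subset\mathbb{R}^3$; it restricts to conformal maps of an open set $\Omega_0\subset\mathbb{R}^2$ and of its complement. The map $h$ is split as $h=h_S$ on $\Omega_0$, with $h_S(\mathbf{x})\in\mathbb{D}$, and $h=h_N$ on $\overline{\mathbb{R}}^2\setminus\Omega_0$, with $h_N(\mathbf{x})\in\overline{\mathbb{R}}^2\setminus\mathbb{D}$. Let $\mathrm{Inv}(\mathbf{x})=\mathbf{x}/|\mathbf{x}|^2$, $\hat{\mathbf{x}}=\mathbf{x}/|\mathbf{x}|^2$, $\hat{\mathbf{y}}=\mathbf{y}/|\mathbf{y}|^2$, $\hat\Omega_0=\mathrm{Inv}(\overline{\mathbb{R}}^2\setminus\Omega_0)$, $h_1:=h_S:\Omega_0\to\mathbb{D}$, and $h_2:=\mathrm{Inv}(h_N)$ regarded as a function $\hat\Omega_0\to\mathbb{D}$ of $\hat{\mathbf{x}}$. The map $g$ is the inverse $g=h^{-1}$, written $$g(\mathbf{y})=\mathbf{1}_{\mathbb{D}}(\mathbf{y})h_1^{-1}(\mathbf{y})+\mathbf{1}_{\mathbb{D}}(\hat{\mathbf{y}})h_2^{-1}(\hat{\mathbf{y}})=:g_1(\mathbf{y})+g_2(\hat{\mathbf{y}}),$$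 with $\mathbf{y}=h_1(\mathbf{x})$, $\hat{\mathbf{y}}=h_2(\hat{\mathbf{x}})$. The displayed Laplace equations are the Euler--Lagrange equations of the Dirichlet energy $$E(g)=\int_{\mathbb{D}}|\nabla_{\mathbf{y}}g_1(\mathbf{y})|_\delta^2\,dy^1\wedge dy^2+\int_{\mathbb{D}}|\nabla_{\hat{\mathbf{y}}}g_2(\hat{\mathbf{y}})|_\delta^2\,d\hat y^2\wedge d\hat y^1,\qquad |\nabla g|_\delta^2=\mathrm{Tr}(\nabla g^\top\nabla g).$$
   Formalization: Off the open disk (circle included) g is Inv(g_2(ŷ)) rather than g_2(ŷ), since h_2^{-1} takes values x̂ and the literal sum is not h^{-1} (e.g. h=id); W^{1,2} is read with Euclidean L² norms piecewise, in the coordinate x on Ω_0 and x̂ on Ω̂_0. *)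

theory Defs
  imports "HOL-Analysis.Analysis"
begin

type_synonym plane = "real^2"

text \<open>The extended plane; \<^term>\<open>None\<close> is the point at infinity.\<close>

type_synonym ext_plane = "plane option"

abbreviation ext_top :: "ext_plane topology" where
  "ext_top \<equiv> Alexandroff_compactification euclidean"

abbreviation unit_disk :: "plane set" where
  "unit_disk \<equiv> ball 0 1"

fun Inv :: "ext_plane \<Rightarrow> ext_plane" where
  "Inv None = Some 0"
| "Inv (Some x) = (if x = 0 then None else Some (x /\<^sub>R (norm x)\<^sup>2))"

text \<open>Finite points are read in the coordinate \<open>x\<close>, points other than 0 in the coordinate
  \<open>Inv x\<close>. Both coordinate changes are involutions, so the same two maps serve as charts and as
  their inverses. Note that \<^const>\<open>Inv\<close> reverses orientation: signs of Jacobian determinants are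
  meaningful only if the same chart is used in the source and in the target.\<close>

definition plane_charts :: "(ext_plane \<Rightarrow> ext_plane) set" where
  "plane_charts = {id, Inv}"

definition in_charts ::
  "(ext_plane \<Rightarrow> ext_plane) \<Rightarrow> (ext_plane \<Rightarrow> ext_plane) \<Rightarrow> (ext_plane \<Rightarrow> ext_plane) \<Rightarrow> plane \<Rightarrow> plane" where
  "in_charts \<sigma> \<tau> F u = the (\<tau> (F (\<sigma> (Some u))))"

definition grad :: "(plane \<Rightarrow> plane) \<Rightarrow> plane \<Rightarrow> real^2^2" where
  "grad F x = matrix (frechet_derivative F (at x))"

definition conformal_at :: "(plane \<Rightarrow> plane) \<Rightarrow> plane \<Rightarrow> bool" where
  "conformal_at F x \<longleftrightarrow>
     F differentiable (at x) \<and> (\<exists>c>0. transpose (grad F x) ** grad F x = mat c)"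

definition conformal_mapping :: "ext_plane set \<Rightarrow> (ext_plane \<Rightarrow> ext_plane) \<Rightarrow> bool" where
  "conformal_mapping S F \<longleftrightarrow>
     continuous_map (subtopology ext_top S) ext_top F \<and> inj_on F S \<and>
     (\<forall>\<sigma>\<in>plane_charts. \<forall>\<tau>\<in>plane_charts. \<forall>u.
        \<sigma> (Some u) \<in> S \<and> \<tau> (F (\<sigma> (Some u))) \<noteq> None \<longrightarrow> conformal_at (in_charts \<sigma> \<tau> F) u)"

definition partial :: "2 \<Rightarrow> (plane \<Rightarrow> 'b::real_normed_vector) \<Rightarrow> plane \<Rightarrow> 'b" where
  "partial i f x = frechet_derivative f (at x) (axis i 1)"

text \<open>Meant for open \<open>U\<close>.\<close>

primrec Ck_on :: "nat \<Rightarrow> plane set \<Rightarrow> (plane \<Rightarrow> 'b::real_normed_vector) \<Rightarrow> bool" where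
  "Ck_on 0 U f \<longleftrightarrow> continuous_on U f"
| "Ck_on (Suc k) U f \<longleftrightarrow> f differentiable_on U \<and> (\<forall>i. Ck_on k U (partial i f))"

definition laplacian :: "(plane \<Rightarrow> 'b::real_normed_vector) \<Rightarrow> plane \<Rightarrow> 'b" where
  "laplacian f x = (\<Sum>i\<in>UNIV. partial i (partial i f) x)"

definition solves_laplace_on :: "plane set \<Rightarrow> (plane \<Rightarrow> plane) \<Rightarrow> bool" where
  "solves_laplace_on U f \<longleftrightarrow> Ck_on 2 U f \<and> (\<forall>x\<in>U. laplacian f x = 0)"

definition test_function :: "plane set \<Rightarrow> (plane \<Rightarrow> real) \<Rightarrow> bool" where
  "test_function U \<phi> \<longleftrightarrow>
     (\<forall>k. Ck_on k UNIV \<phi>) \<and> compact (closure {x. \<phi> x \<noteq> 0}) \<and> closure {x. \<phi> x \<noteq> 0} \<subseteq> U"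

definition L2_on :: "plane set \<Rightarrow> (plane \<Rightarrow> real) \<Rightarrow> bool" where
  "L2_on U f \<longleftrightarrow>
     set_borel_measurable lebesgue U f \<and> set_integrable lebesgue U (\<lambda>x. (f x)\<^sup>2)"

definition weak_partial_on :: "plane set \<Rightarrow> 2 \<Rightarrow> (plane \<Rightarrow> real) \<Rightarrow> (plane \<Rightarrow> real) \<Rightarrow> bool" where
  "weak_partial_on U i f v \<longleftrightarrow>
     (\<forall>\<phi>. test_function U \<phi> \<longrightarrow>
        (LINT x:U|lebesgue. f x * partial i \<phi> x) = - (LINT x:U|lebesgue. v x * \<phi> x))"

definition W12_on :: "plane set \<Rightarrow> (plane \<Rightarrow> plane) \<Rightarrow> bool" where
  "W12_on U F \<longleftrightarrow>
     (\<forall>j. L2_on U (\<lambda>x. F x $ j) \<and>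
        (\<forall>i. \<exists>v. L2_on U v \<and> weak_partial_on U i (\<lambda>x. F x $ j) v))"

text \<open>A Sobolev map on a subset \<open>S\<close> of the extended plane is, like the Dirichlet energy, split
  along \<open>\<Omega>\<close>: the part over \<open>\<Omega>\<close> is read in the coordinate \<open>x\<close> and the part over the complement of
  \<open>\<Omega>\<close> in the coordinate \<open>Inv x\<close>, in the source as well as in the target. All integrals are taken
  with respect to the Euclidean metric of the respective coordinate.\<close>

definition W12_split :: "plane set \<Rightarrow> ext_plane set \<Rightarrow> (ext_plane \<Rightarrow> ext_plane) \<Rightarrow> bool" where
  "W12_split \<Omega> S F \<longleftrightarrow>
     W12_on {u \<in> \<Omega>. Some u \<in> S} (in_charts id id F) \<and>
     W12_on (interior {u. Inv (Some u) \<in> S - Some ` \<Omega>}) (in_charts Inv Inv F)"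

definition h1 :: "(ext_plane \<Rightarrow> ext_plane) \<Rightarrow> plane \<Rightarrow> plane" where
  "h1 h = in_charts id id h"

definition h2 :: "(ext_plane \<Rightarrow> ext_plane) \<Rightarrow> plane \<Rightarrow> plane" where
  "h2 h = in_charts Inv Inv h"

text \<open>The finite points of the inverted complement of \<open>\<Omega>\<close>; these are all of its points if and only
  if \<open>0 \<in> \<Omega>\<close>.\<close>

definition Omega_hat :: "plane set \<Rightarrow> plane set" where
  "Omega_hat \<Omega> = {u. Inv (Some u) \<notin> Some ` \<Omega>}"

definition g1 :: "plane set \<Rightarrow> (ext_plane \<Rightarrow> ext_plane) \<Rightarrow> plane \<Rightarrow> plane" where
  "g1 \<Omega> h = inv_into \<Omega> (h1 h)"

definition g2 :: "plane set \<Rightarrow> (ext_plane \<Rightarrow> ext_plane) \<Rightarrow> plane \<Rightarrow> plane" where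
  "g2 \<Omega> h = inv_into (Omega_hat \<Omega>) (h2 h)"

text \<open>The sum of \<open>g1 (y)\<close> and \<open>g2 (Inv y)\<close>, each cut off outside its own domain, is the map that
  is \<open>g1\<close> on the disk and \<open>g2\<close> off the disk. As \<open>h2\<close> is a function of the coordinate \<open>Inv x\<close>, the
  value of its inverse is the \<open>Inv x\<close>-coordinate of a point of the extended plane.\<close>

definition glue :: "(plane \<Rightarrow> plane) \<Rightarrow> (plane \<Rightarrow> plane) \<Rightarrow> ext_plane \<Rightarrow> ext_plane" where
  "glue G1 G2 y =
     (if y \<in> Some ` unit_disk then Some (G1 (the y)) else Inv (Some (G2 (the (Inv y)))))"

definition dirichlet_solution :: "(plane \<Rightarrow> ext_plane) \<Rightarrow> (plane \<Rightarrow> plane) \<Rightarrow> bool" where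
  "dirichlet_solution b u \<longleftrightarrow>
     continuous_on (cball 0 1) u \<and> solves_laplace_on unit_disk u \<and>
     (\<forall>y\<in>sphere 0 1. Some (u y) = b y)"

text \<open>The Laplace equation determines a function only together with its boundary values.\<close>

definition determined_by_laplace :: "(plane \<Rightarrow> ext_plane) \<Rightarrow> (plane \<Rightarrow> plane) \<Rightarrow> bool" where
  "determined_by_laplace b G \<longleftrightarrow>
     (\<exists>u. dirichlet_solution b u) \<and>
     (\<forall>u. dirichlet_solution b u \<longrightarrow> (\<forall>y\<in>unit_disk. u y = G y))"

text \<open>The chart \<^const>\<open>id\<close> gives the condition at all points of the plane with its Euclidean
  metric; the chart \<^const>\<open>Inv\<close> gives the corresponding condition near infinity.\<close>

definition equiareal :: "(ext_plane \<Rightarrow> ext_plane) \<Rightarrow> bool" where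
  "equiareal F \<longleftrightarrow>
     (\<forall>\<sigma>\<in>plane_charts. \<forall>u. \<sigma> (F (\<sigma> (Some u))) \<noteq> None \<and>
        in_charts \<sigma> \<sigma> F differentiable (at u) \<and> det (grad (in_charts \<sigma> \<sigma> F) u) = 1)"

end

theory Submission
  imports Defs "HOL-Complex_Analysis.Cauchy_Integral_Formula"
begin

text \<open>
  A conformal self-map \<open>h\<close> of the sphere with positive Jacobian is a Moebius transformation: if \<open>h\<close>
  fixes infinity it is entire, otherwise \<open>1 / (h - h \<infinity>)\<close> is, and conformality at infinity bounds the
  growth of this entire function linearly, so that it is affine by Liouville's theorem.

  The Sobolev hypothesis locates the poles of \<open>g = h\<inverse>\<close> in the two charts. If \<open>h \<infinity>\<close> lay on the unit
  circle, or if \<open>0\<close> were not in \<open>\<Omega>\<^sub>0\<close>, one of the two coordinate domains would contain a cone on which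
  the coordinate expression of \<open>h\<close> decays at most like \<open>1 / |u|\<close>, which is not square integrable in the
  plane. Hence both coordinate expressions of \<open>g\<close> are Moebius maps without poles on the closed disk;
  they are holomorphic there, which gives the Laplace equations and the Sobolev regularity, and the
  maximum principle shows that they are determined by their boundary values.
\<close>

section \<open>Coordinates and conformality\<close>

text \<open>The obstacle is the unit circle. The splitting of \<open>h\<close> allows infinity to be
  sent to the circle; then \<open>g\<close> has a pole on the boundary and the Dirichlet problem
  there has no finite boundary values. Square integrability excludes this: near infinity the domain
  would look like a half-plane on which \<open>h\<close> stays near a point of modulus 1. The
  half-plane is known only to first order, hence the cones strictly inside it. The other coordinate
  is treated likewise at 0, whose image could moreover lie beyond the circle or be infinity.
  \<open>Inv\<close> is reflection in the unit circle, z -> 1 / cnj z. Read through it in source and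
  target, a Moebius map stays a Moebius map; through it on one side only, it becomes the conjugate
  of one. So both coordinate expressions of \<open>g\<close> fall under a single lemma on Moebius
  maps without poles on the closed disk.\<close>

definition cx :: "plane \<Rightarrow> complex" where
  "cx x = Complex (x $ 1) (x $ 2)"

definition pl :: "complex \<Rightarrow> plane" where
  "pl z = vector [Re z, Im z]"

lemma pl_nth [simp]: "pl z $ 1 = Re z" "pl z $ 2 = Im z"
  by (simp_all add: pl_def)

lemma Re_cx [simp]: "Re (cx x) = x $ 1" and Im_cx [simp]: "Im (cx x) = x $ 2"
  by (simp_all add: cx_def)

lemma pl_cx [simp]: "pl (cx x) = x"
  by (simp add: vec_eq_iff forall_2)

lemma cx_pl [simp]: "cx (pl z) = z"
  by (simp add: complex_eq_iff)

lemma cx_eq_iff [simp]: "cx x = cx y \<longleftrightarrow> x = y"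
  by (metis pl_cx)

lemma pl_eq_iff [simp]: "pl x = pl y \<longleftrightarrow> x = y"
  by (metis cx_pl)

lemma inner_plane: "(x::plane) \<bullet> y = x $ 1 * y $ 1 + x $ 2 * y $ 2"
  by (simp add: inner_vec_def sum_2)

lemma norm_plane: "norm (x::plane) = sqrt ((x $ 1)\<^sup>2 + (x $ 2)\<^sup>2)"
  by (simp add: norm_eq_sqrt_inner inner_plane power2_eq_square)

lemma norm_cx [simp]: "norm (cx x) = norm x"
  by (simp add: norm_plane cmod_def)

lemma norm_pl [simp]: "norm (pl z) = norm z"
  by (metis cx_pl norm_cx)

lemma linear_cx: "linear cx"
  by (rule linearI) (simp_all add: complex_eq_iff)

lemma linear_pl: "linear pl"
  by (rule linearI) (simp_all add: vec_eq_iff forall_2)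

lemma bounded_linear_cx: "bounded_linear cx"
  using linear_cx linear_conv_bounded_linear by blast

lemma bounded_linear_pl: "bounded_linear pl"
  using linear_pl linear_conv_bounded_linear by blast

lemmas cx_simps [simp] =
  linear_add[OF linear_cx] linear_diff[OF linear_cx] linear_0[OF linear_cx] linear_scale[OF linear_cx]
lemmas pl_simps [simp] =
  linear_add[OF linear_pl] linear_diff[OF linear_pl] linear_0[OF linear_pl] linear_scale[OF linear_pl]

lemmas continuous_on_cx [continuous_intros] = bounded_linear.continuous_on[OF bounded_linear_cx]
lemmas continuous_on_pl [continuous_intros] = bounded_linear.continuous_on[OF bounded_linear_pl]
lemmas has_derivative_cx = bounded_linear.has_derivative[OF bounded_linear_cx]
lemmas has_derivative_pl = bounded_linear.has_derivative[OF bounded_linear_pl]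

lemma cx_eq_0_iff [simp]: "cx x = 0 \<longleftrightarrow> x = 0"
  by (metis cx_eq_iff cx_simps(3))

lemma pl_eq_0_iff [simp]: "pl z = 0 \<longleftrightarrow> z = 0"
  by (metis pl_eq_iff pl_simps(3))

lemma axis_plane_nth [simp]:
  "axis (1::2) (a::real) $ 1 = a" "axis (1::2) (a::real) $ 2 = 0"
  "axis (2::2) (a::real) $ 1 = 0" "axis (2::2) (a::real) $ 2 = a"
  by (simp_all add: axis_def)

lemma has_derivative_grad:
  assumes "(F has_derivative D) (at x)"
  shows "grad F x *v v = D v"
proof -
  have "frechet_derivative F (at x) = D"
    using assms frechet_derivative_at by metis
  then show ?thesis
    using assms by (simp add: grad_def matrix_works has_derivative_linear)
qed

text \<open>Matrix-free form: the derivative is a similarity. It rests on v . (A^T A w) = (A v) . (A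
  w) and on a vector being determined by its inner products.\<close>

lemma conformal_at_iff:
  "conformal_at F x \<longleftrightarrow>
     (\<exists>D c. c > 0 \<and> (F has_derivative D) (at x) \<and> (\<forall>v w. D v \<bullet> D w = c * (v \<bullet> w)))"
proof
  assume "conformal_at F x"
  then obtain c where c: "c > 0" "F differentiable (at x)" "transpose (grad F x) ** grad F x = mat c"
    unfolding conformal_at_def by blast
  define D where "D = frechet_derivative F (at x)"
  have D: "(F has_derivative D) (at x)"
    using c by (simp add: D_def frechet_derivative_works[symmetric])
  have "D v \<bullet> D w = c * (v \<bullet> w)" for v w
  proof -
    let ?A = "grad F x"
    have "D v \<bullet> D w = (?A *v v) \<bullet> (?A *v w)"
      by (simp add: has_derivative_grad[OF D])
    also have "\<dots> = v \<bullet> ((transpose ?A ** ?A) *v w)"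
      by (metis dot_lmul_matrix matrix_vector_mul_assoc vector_transpose_matrix)
    also have "\<dots> = c * (v \<bullet> w)"
      by (simp add: c(3) inner_plane matrix_vector_mult_def mat_def sum_2 algebra_simps)
    finally show ?thesis .
  qed
  with c D show "\<exists>D c. c > 0 \<and> (F has_derivative D) (at x) \<and> (\<forall>v w. D v \<bullet> D w = c * (v \<bullet> w))"
    by blast
next
  assume "\<exists>D c. c > 0 \<and> (F has_derivative D) (at x) \<and> (\<forall>v w. D v \<bullet> D w = c * (v \<bullet> w))"
  then obtain D c where D: "c > 0" "(F has_derivative D) (at x)" "\<And>v w. D v \<bullet> D w = c * (v \<bullet> w)"
    by blast
  let ?A = "grad F x"
  have "(transpose ?A ** ?A) *v w = mat c *v w" for w
  proof (subst vector_eq_ldot[symmetric], rule allI)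
    fix v
    have "v \<bullet> ((transpose ?A ** ?A) *v w) = (?A *v v) \<bullet> (?A *v w)"
      by (metis dot_lmul_matrix matrix_vector_mul_assoc vector_transpose_matrix)
    also have "\<dots> = c * (v \<bullet> w)"
      by (simp add: D(3) has_derivative_grad[OF D(2)])
    also have "\<dots> = v \<bullet> (mat c *v w)"
      by (simp add: inner_plane matrix_vector_mult_def mat_def sum_2 algebra_simps)
    finally show "v \<bullet> ((transpose ?A ** ?A) *v w) = v \<bullet> (mat c *v w)" .
  qed
  then have "transpose ?A ** ?A = mat c"
    by (simp add: matrix_eq)
  then show "conformal_at F x"
    using D(1,2) unfolding conformal_at_def by (auto simp: differentiable_def)
qed

lemma conformal_at_bounds:
  assumes "conformal_at F x"
  obtains D s where "s > 0" "(F has_derivative D) (at x)"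
    "\<And>v w. D v \<bullet> D w = s\<^sup>2 * (v \<bullet> w)" "\<And>v. norm (D v) = s * norm v"
proof -
  obtain D c where D: "c > 0" "(F has_derivative D) (at x)" "\<And>v w. D v \<bullet> D w = c * (v \<bullet> w)"
    using assms unfolding conformal_at_iff by blast
  show thesis
  proof (rule that[of "sqrt c" D])
    show "norm (D v) = sqrt c * norm v" for v
      using D by (simp add: norm_eq_sqrt_inner real_sqrt_mult)
  qed (use D in auto)
qed

text \<open>The derivative stretches every vector by the same factor \<open>s\<close>, and a
  remainder of at most \<open>s/2\<close> times the displacement cannot cancel that. In the charts
  at infinity this becomes the growth bound for Liouville's theorem.\<close>

lemma conformal_at_lower_bound:
  assumes "conformal_at F x"
  obtains c d where "c > 0" "d > 0" "\<And>y. norm (y - x) < d \<Longrightarrow> c * norm (y - x) \<le> norm (F y - F x)"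
proof -
  obtain D s where D: "s > 0" "(F has_derivative D) (at x)" "\<And>v. norm (D v) = s * norm v"
    using conformal_at_bounds[OF assms] by metis
  obtain d where d: "d > 0" "\<And>y. norm (y - x) < d \<Longrightarrow> norm (F y - F x - D (y - x)) \<le> s/2 * norm (y - x)"
    using D(1,2) unfolding has_derivative_at_alt by (metis half_gt_zero)
  show thesis
  proof (rule that[of "s/2" d])
    fix y assume "norm (y - x) < d"
    then have "norm (F y - F x - D (y - x)) \<le> s/2 * norm (y - x)" by (rule d)
    moreover have "norm (D (y - x)) \<le> norm (F y - F x - D (y - x)) + norm (F y - F x)"
      by (metis norm_minus_commute norm_triangle_sub add.commute)
    ultimately show "s/2 * norm (y - x) \<le> norm (F y - F x)"
      by (simp add: D(3))
  qed (use D d in auto)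
qed

text \<open>A linear similarity of the plane is multiplication by a complex number, possibly
  combined with conjugation; the positive determinant excludes the conjugation.\<close>

lemma conformal_at_det_pos_imp_complex:
  assumes "conformal_at F x" "det (grad F x) > 0"
  shows "(\<lambda>z. cx (F (pl z))) field_differentiable at (cx x)"
proof -
  obtain D c where D: "c > 0" "(F has_derivative D) (at x)" "\<And>v w. D v \<bullet> D w = c * (v \<bullet> w)"
    using assms unfolding conformal_at_iff by blast
  define a b d e where "a = D (axis 1 1) $ 1" "b = D (axis 1 1) $ 2"
    "d = D (axis 2 1) $ 1" "e = D (axis 2 1) $ 2"
  note [simp] = a_b_d_e_def[symmetric]
  have Dv: "D v = (v $ 1) *\<^sub>R D (axis 1 1) + (v $ 2) *\<^sub>R D (axis 2 1)" for v
  proof -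
    have "D v = D ((v $ 1) *\<^sub>R axis 1 1 + (v $ 2) *\<^sub>R axis 2 1)"
      by (rule arg_cong[of _ _ D]) (simp add: vec_eq_iff forall_2)
    also have "\<dots> = (v $ 1) *\<^sub>R D (axis 1 1) + (v $ 2) *\<^sub>R D (axis 2 1)"
      using has_derivative_linear[OF D(2)] by (simp add: linear_add linear_scale)
    finally show ?thesis .
  qed
  have 1: "a\<^sup>2 + b\<^sup>2 = c" "d\<^sup>2 + e\<^sup>2 = c" "a * d + b * e = 0"
    using D(3)[of "axis 1 1" "axis 1 1"] D(3)[of "axis 2 1" "axis 2 1"]
      D(3)[of "axis 1 1" "axis 2 1"]
    by (simp_all add: inner_plane power2_eq_square)
  have g: "grad F x $ i $ j = D (axis j 1) $ i" for i j
    using arg_cong[OF has_derivative_grad[OF D(2), of "axis j 1"], of "\<lambda>v. v $ i"]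
    by (simp add: matrix_vector_mult_basis column_def)
  have det: "a * e - d * b > 0"
    using assms(2) by (simp add: det_2 g)
  \<comment> \<open>Lagrange's identity: for orthogonal columns the squared determinant is the
    product of the squared lengths.\<close>
  have "(a * e - d * b)\<^sup>2 = c\<^sup>2"
  proof -
    have "(a * e - d * b)\<^sup>2 + (a * d + b * e)\<^sup>2 = (a\<^sup>2 + b\<^sup>2) * (d\<^sup>2 + e\<^sup>2)" by algebra
    then show ?thesis by (simp only: 1) (simp add: power2_eq_square)
  qed
  then have "a * e - d * b = c"
    using det D(1) by (simp add: power2_eq_iff)
  \<comment> \<open>The squares contribute 2 c and the cross terms -2 times the determinant. The
    result is the Cauchy-Riemann equations.\<close>
  then have "(d + b)\<^sup>2 + (e - a)\<^sup>2 = 0"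
    using 1 by (simp add: power2_eq_square algebra_simps)
  then have de: "d = - b" "e = a"
    by auto
  have "((\<lambda>z. cx (F (pl z))) has_derivative (\<lambda>v. cx (D (pl v)))) (at (cx x))"
    by (rule has_derivative_cx, rule has_derivative_compose[of pl pl])
       (use D(2) bounded_linear_pl in \<open>auto intro: bounded_linear_imp_has_derivative\<close>)
  also have "(\<lambda>v. cx (D (pl v))) = (*) (Complex a b)"
    by (rule ext) (subst Dv, simp add: complex_eq_iff de algebra_simps)
  finally show ?thesis
    unfolding field_differentiable_def has_field_derivative_def by blast
qed

text \<open>Multiplication by \<open>a\<close> scales inner products by |a|^2 and conjugation
  preserves them. The conjugate version serves the mixed chart pairs, where \<open>Inv\<close> on
  one side reverses orientation.\<close>

lemma conformal_at_complex:
  assumes "(f has_field_derivative a) (at (cx x))" "a \<noteq> 0"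
  shows "conformal_at (\<lambda>u. pl (f (cx u))) x" "conformal_at (\<lambda>u. pl (cnj (f (cx u)))) x"
proof -
  have D: "((\<lambda>u. f (cx u)) has_derivative (\<lambda>v. a * cx v)) (at x)"
    by (rule has_derivative_compose[of cx cx])
       (use assms bounded_linear_cx in \<open>auto intro: bounded_linear_imp_has_derivative simp: has_field_derivative_def\<close>)
  show "conformal_at (\<lambda>u. pl (f (cx u))) x"
    unfolding conformal_at_iff
  proof (intro exI conjI allI)
    show "((\<lambda>u. pl (f (cx u))) has_derivative (\<lambda>v. pl (a * cx v))) (at x)"
      using D by (rule has_derivative_pl)
    show "(norm a)\<^sup>2 > 0" using assms by simp
    show "pl (a * cx v) \<bullet> pl (a * cx w) = (norm a)\<^sup>2 * (v \<bullet> w)" for v w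
      unfolding inner_plane cmod_power2 by (simp, algebra)
  qed
  show "conformal_at (\<lambda>u. pl (cnj (f (cx u)))) x"
    unfolding conformal_at_iff
  proof (intro exI conjI allI)
    show "((\<lambda>u. pl (cnj (f (cx u)))) has_derivative (\<lambda>v. pl (cnj (a * cx v)))) (at x)"
      by (intro has_derivative_pl bounded_linear.has_derivative[OF bounded_linear_cnj] D)
    show "(norm a)\<^sup>2 > 0" using assms by simp
    show "pl (cnj (a * cx v)) \<bullet> pl (cnj (a * cx w)) = (norm a)\<^sup>2 * (v \<bullet> w)" for v w
      unfolding inner_plane cmod_power2 by (simp, algebra)
  qed
qed

section \<open>Moebius transformations\<close>

text \<open>The four coefficients stay explicit because composing with \<open>Inv\<close> merely
  permutes and conjugates them. Nondegeneracy is left to the lemmas.\<close>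

definition mob :: "complex \<Rightarrow> complex \<Rightarrow> complex \<Rightarrow> complex \<Rightarrow> ext_plane \<Rightarrow> ext_plane" where
  "mob p q r s x = (case x of
     None \<Rightarrow> if r = 0 then None else Some (pl (p / r))
   | Some u \<Rightarrow> if r * cx u + s = 0 then None else Some (pl ((p * cx u + q) / (r * cx u + s))))"

definition ext_cnj :: "ext_plane \<Rightarrow> ext_plane" where
  "ext_cnj = map_option (\<lambda>u. pl (cnj (cx u)))"

lemma ext_cnj_ext_cnj [simp]: "ext_cnj (ext_cnj x) = x"
  by (cases x) (auto simp: ext_cnj_def)

lemma ext_cnj_eq_None_iff [simp]: "ext_cnj x = None \<longleftrightarrow> x = None"
  by (auto simp: ext_cnj_def)

lemma Inv_Some_complex: "u \<noteq> 0 \<Longrightarrow> Inv (Some u) = Some (pl (1 / cnj (cx u)))"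
  by (simp add: vec_eq_iff forall_2 Re_divide Im_divide norm_plane divide_simps)

lemma Inv_Inv [simp]: "Inv (Inv x) = x"
proof (cases x)
  case (Some u)
  then show ?thesis
    by (cases "u = 0") (simp_all add: Inv_Some_complex del: Inv.simps(2), simp)
qed simp

lemma Inv_eq_None_iff [simp]: "Inv x = None \<longleftrightarrow> x = Some 0"
  by (cases x) auto

lemma Inv_inj [simp]: "Inv x = Inv y \<longleftrightarrow> x = y"
  by (metis Inv_Inv)

lemma norm_Inv: "Inv (Some u) = Some v \<Longrightarrow> norm v = 1 / norm u"
  by (auto split: if_splits simp: power2_eq_square divide_simps)

lemma Inv_Some_0 [simp]: "Inv (Some 0) = None"
  by simp

declare Inv.simps(2) [simp del]

text \<open>The inverse has the coefficients of the adjugate matrix; the factor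
  \<open>p * s - q * r\<close> cancels in the quotient.\<close>

lemma mob_inverse:
  assumes "p * s - q * r \<noteq> 0"
  shows "mob s (- q) (- r) p (mob p q r s x) = x"
proof (cases x)
  case None
  then show ?thesis
    using assms by (auto simp: mob_def field_simps)
next
  case (Some u)
  show ?thesis
  proof (cases "r * cx u + s = 0")
    case True
    then have "s = - (r * cx u)" by (simp add: eq_neg_iff_add_eq_0 add.commute)
    then show ?thesis
      using assms True Some by (auto simp: mob_def)
  next
    case False
    define d where "d = r * cx u + s"
    have "p - r * ((p * cx u + q) / d) = (p * s - q * r) / d"
      using False by (simp add: d_def field_simps)
    moreover have "s * ((p * cx u + q) / d) - q = (p * s - q * r) * cx u / d"
      using False by (simp add: d_def field_simps)
    ultimately show ?thesis
      using assms False by (simp add: mob_def Some flip: d_def)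
  qed
qed

lemma ext_cnj_mob: "ext_cnj (mob p q r s x) = mob (cnj p) (cnj q) (cnj r) (cnj s) (ext_cnj x)"
proof -
  have "r * cx u + s = 0 \<longleftrightarrow> cnj r * cnj (cx u) + cnj s = 0" for u
    by (metis complex_cnj_add complex_cnj_mult complex_cnj_zero_iff)
  then show ?thesis
    by (cases x) (auto simp: mob_def ext_cnj_def)
qed

text \<open>\<open>Inv\<close> is 1 / z followed by conjugation, so numerator and denominator trade
  places. Nondegeneracy keeps them from vanishing together.\<close>

lemma Inv_mob:
  assumes "p * s - q * r \<noteq> 0"
  shows "Inv (mob p q r s x) = ext_cnj (mob r s p q x)"
proof (cases x)
  case None
  then show ?thesis
    using assms by (auto simp: mob_def ext_cnj_def Inv_Some_complex)
next
  case (Some u)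
  have "\<not> (p * cx u + q = 0 \<and> r * cx u + s = 0)"
  proof
    assume a: "p * cx u + q = 0 \<and> r * cx u + s = 0"
    have "p * s - q * r = p * (r * cx u + s) - r * (p * cx u + q)" by (simp add: algebra_simps)
    with a assms show False by simp
  qed
  then consider "p * cx u + q = 0" "r * cx u + s \<noteq> 0" | "p * cx u + q \<noteq> 0" "r * cx u + s = 0"
    | "p * cx u + q \<noteq> 0" "r * cx u + s \<noteq> 0"
    by blast
  then show ?thesis
  proof cases
    case 3
    then show ?thesis
      by (simp add: Some mob_def ext_cnj_def Inv_Some_complex)
  qed (simp_all add: Some mob_def ext_cnj_def)
qed

text \<open>Substituting 1 / cnj z and clearing denominators exchanges the columns of the
  coefficient matrix.\<close>

lemma mob_Inv: "mob p q r s (Inv x) = mob q p s r (ext_cnj x)"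
proof (cases x)
  case (Some u)
  show ?thesis
  proof (cases "u = 0")
    case False
    then have 1: "r / cnj (cx u) + s = (s * cnj (cx u) + r) / cnj (cx u)"
      and 2: "p / cnj (cx u) + q = (q * cnj (cx u) + p) / cnj (cx u)"
      by (simp_all add: field_simps)
    show ?thesis
      using False
      by (simp add: Some mob_def ext_cnj_def Inv_Some_complex 1 2)
  qed (simp add: Some mob_def ext_cnj_def)
qed (simp add: mob_def ext_cnj_def)

text \<open>The two orientation reversals cancel. This is why the part of \<open>g\<close> near
  infinity, read in the inverted coordinate, is again a Moebius map.\<close>

lemma Inv_mob_Inv:
  assumes "p * s - q * r \<noteq> 0"
  shows "Inv (mob p q r s (Inv x)) = mob (cnj s) (cnj r) (cnj q) (cnj p) x"
  using assms by (subst mob_Inv, subst Inv_mob) (simp_all add: ext_cnj_mob mult.commute)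

lemma mob_has_field_derivative:
  assumes "r * z + s \<noteq> (0::complex)"
  shows "((\<lambda>z. (p * z + q) / (r * z + s)) has_field_derivative
           (p * s - q * r) / (r * z + s)\<^sup>2) (at z)"
  by (rule derivative_eq_intros refl assms)+
     (use assms in \<open>simp add: power2_eq_square algebra_simps\<close>)

lemma open_mob_domain: "open {u. r * cx u + s \<noteq> 0}"
  by (intro open_Collect_neq continuous_intros)

lemma conformal_at_transform:
  assumes "conformal_at F x" "open U" "x \<in> U" "\<And>u. u \<in> U \<Longrightarrow> F u = G u"
  shows "conformal_at G x"
  using assms unfolding conformal_at_iff
  by (meson has_derivative_transform_within_open)

lemma conformal_at_mob:
  assumes "p * s - q * r \<noteq> 0" "mob p q r s (Some u) \<noteq> None"
  shows "conformal_at (\<lambda>u. the (mob p q r s (Some u))) u"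
    "conformal_at (\<lambda>u. the (ext_cnj (mob p q r s (Some u)))) u"
proof -
  have nz: "r * cx u + s \<noteq> 0"
    using assms(2) by (auto simp: mob_def)
  note D = mob_has_field_derivative[OF nz, of p q]
  have "(p * s - q * r) / (r * cx u + s)\<^sup>2 \<noteq> 0"
    using assms nz by simp
  note c = conformal_at_complex[OF D this]
  show "conformal_at (\<lambda>u. the (mob p q r s (Some u))) u"
    by (rule conformal_at_transform[OF c(1) open_mob_domain[of r s]])
       (use nz in \<open>auto simp: mob_def\<close>)
  show "conformal_at (\<lambda>u. the (ext_cnj (mob p q r s (Some u)))) u"
    by (rule conformal_at_transform[OF c(2) open_mob_domain[of r s]])
       (use nz in \<open>auto simp: mob_def ext_cnj_def\<close>)
qed

lemma conformal_at_mob_in_charts: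
  assumes "p * s - q * r \<noteq> 0" "\<sigma> \<in> plane_charts" "\<tau> \<in> plane_charts"
    "\<tau> (mob p q r s (\<sigma> (Some u))) \<noteq> None"
  shows "conformal_at (in_charts \<sigma> \<tau> (mob p q r s)) u"
proof -
  have nz: "r * q - s * p \<noteq> 0" "cnj q * cnj r - cnj p * cnj s \<noteq> 0" "cnj s * cnj p - cnj r * cnj q \<noteq> 0"
    using assms(1) by (simp_all add: mult.commute flip: complex_cnj_mult complex_cnj_diff)
  \<comment> \<open>Moves the conjugation caused by a source chart \<open>Inv\<close> to the target
    side, where \<open>conformal_at_mob\<close> can absorb it.\<close>
  have flip: "mob p q r s (Inv x) = ext_cnj (mob (cnj q) (cnj p) (cnj s) (cnj r) x)" for x
    by (simp add: mob_Inv ext_cnj_mob)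
  consider "\<sigma> = id" "\<tau> = id" | "\<sigma> = id" "\<tau> = Inv" | "\<sigma> = Inv" "\<tau> = id" | "\<sigma> = Inv" "\<tau> = Inv"
    using assms by (auto simp: plane_charts_def)
  then show ?thesis
  proof cases
    case 1
    then show ?thesis
      using conformal_at_mob(1)[of p s q r u] assms by (simp add: in_charts_def[abs_def])
  next
    case 2
    then show ?thesis
      using conformal_at_mob(2)[of r q s p u] assms nz
      by (simp add: in_charts_def[abs_def] Inv_mob del: Inv_eq_None_iff)
  next
    case 3
    then show ?thesis
      using conformal_at_mob(2)[of "cnj q" "cnj r" "cnj p" "cnj s" u] assms nz
      by (simp add: in_charts_def[abs_def] flip)
  next
    case 4
    then show ?thesis
      using conformal_at_mob(1)[of "cnj s" "cnj p" "cnj r" "cnj q" u] assms nz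
      by (simp add: in_charts_def[abs_def] Inv_mob_Inv del: Inv_eq_None_iff)
  qed
qed

lemma linear_growth_imp_affine:
  assumes "f holomorphic_on UNIV" "\<And>z. A \<le> norm z \<Longrightarrow> norm (f z) \<le> B * norm z"
  obtains \<alpha> \<beta> where "\<And>z. f z = \<alpha> * z + \<beta>"
proof
  show "f z = deriv f 0 * z + f 0" for z
    using Liouville_polynomial[of f A B 1 z] assms by simp
qed

lemma conformal_mapping_UNIV_imp_mob:
  assumes conf: "conformal_mapping UNIV h"
    and det: "\<And>x. h (Some x) \<noteq> None \<Longrightarrow> det (grad (in_charts id id h) x) > 0"
  obtains p q r s where "p * s - q * r \<noteq> 0" "h = mob p q r s"
proof -
  have inj: "h x = h y \<longleftrightarrow> x = y" for x y
    using conf by (auto simp: conformal_mapping_def inj_on_def)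
  have charts: "conformal_at (in_charts \<sigma> \<tau> h) u"
    if "\<sigma> \<in> {id, Inv}" "\<tau> \<in> {id, Inv}" "\<tau> (h (\<sigma> (Some u))) \<noteq> None" for \<sigma> \<tau> u
    using conf that unfolding conformal_mapping_def plane_charts_def by blast
  \<comment> \<open>\<open>f\<close> is \<open>h\<close> in complex coordinates, with a meaningless
    value on the set \<open>P\<close> of poles; by injectivity \<open>P\<close> has at most one
    element.\<close>
  define f where "f z = cx (the (h (Some (pl z))))" for z
  define P where "P = {z. h (Some (pl z)) = None}"
  have h_eq: "h (Some (pl z)) = Some (pl (f z))" if "z \<notin> P" for z
    using that by (auto simp: f_def P_def)
  have "f field_differentiable at z" if "z \<notin> P" for z
  proof -
    have "conformal_at (in_charts id id h) (pl z)"
      by (rule charts) (use that in \<open>auto simp: P_def\<close>)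
    moreover have "det (grad (in_charts id id h) (pl z)) > 0"
      by (rule det) (use that in \<open>auto simp: P_def\<close>)
    ultimately have "(\<lambda>z. cx (in_charts id id h (pl z))) field_differentiable at (cx (pl z))"
      by (rule conformal_at_det_pos_imp_complex)
    moreover have "(\<lambda>z. cx (in_charts id id h (pl z))) = f"
      by (simp add: f_def in_charts_def fun_eq_iff)
    ultimately show ?thesis by simp
  qed
  then have hol: "f holomorphic_on - P"
    by (simp add: holomorphic_on_def field_differentiable_at_within)
  have inv_pt: "\<exists>u. norm u = 1 / norm z \<and> Inv (Some u) = Some (pl z) \<and> norm u < d"
    if "2 / d \<le> norm z" "d > 0" for z d
  proof -
    have z: "norm z > 0" using that by (smt (verit) divide_pos_pos)
    obtain u where u: "Inv (Some (pl z)) = Some u"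
      using z by fastforce
    have "norm u = 1 / norm z"
      using norm_Inv[OF u] by simp
    moreover have "1 / norm z < d"
      using that z by (simp add: field_simps)
    ultimately show ?thesis
      using u by (metis Inv_Inv)
  qed
  show thesis
  proof (cases "h None")
    case None
    then have "z \<notin> P" for z
      using inj[of "Some (pl z)" None] by (auto simp: P_def)
    then have P: "P = {}" by blast
    define F where "F = in_charts Inv Inv h"
    have "conformal_at F 0" and F0: "F 0 = 0"
      using None by (auto simp: F_def in_charts_def intro: charts)
    then obtain c d where cd: "c > 0" "d > 0"
      "\<And>y. norm (y - 0) < d \<Longrightarrow> c * norm (y - 0) \<le> norm (F y - F 0)"
      using conformal_at_lower_bound by blast
    \<comment> \<open>At u = Inv z the chart expression has modulus 1 / |f z|, while conformality at
      infinity bounds it below by c |u| = c / |z|.\<close>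
    have "norm (f z) \<le> 1 / c * norm z" if z: "2 / d \<le> norm z" for z
    proof (cases "f z = 0")
      case False
      obtain u where u: "norm u = 1 / norm z" "Inv (Some u) = Some (pl z)" "norm u < d"
        using inv_pt[OF z cd(2)] by blast
      have "norm z > 0" using z cd(2) by (smt (verit) divide_pos_pos)
      have "norm (F u) = 1 / norm (f z)"
        using False h_eq[of z] P norm_Inv[of "pl (f z)"] by (simp add: F_def in_charts_def u(2))
      then show ?thesis
        using cd(1) cd(3)[of u] u(1,3) False \<open>norm z > 0\<close> by (simp add: F0) (simp add: field_simps)
    qed (use cd in auto)
    then obtain \<alpha> \<beta> where ab: "\<And>z. f z = \<alpha> * z + \<beta>"
      using linear_growth_imp_affine[of f "2 / d" "1 / c"] hol P by auto
    have "\<alpha> \<noteq> 0"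
    proof
      assume "\<alpha> = 0"
      then have "h (Some (pl 0)) = h (Some (pl 1))"
        using h_eq[of 0] h_eq[of 1] P ab by simp
      then show False unfolding inj by (simp only: option.inject pl_eq_iff) simp
    qed
    have "h x = mob \<alpha> \<beta> 0 1 x" for x
      using None h_eq[of "cx (the x)"] P ab by (cases x) (auto simp: mob_def)
    with \<open>\<alpha> \<noteq> 0\<close> show thesis
      by (intro that[of \<alpha> 1 \<beta> 0]) auto
  next
    case (Some a)
    define b where "b = cx a"
    \<comment> \<open>By injectivity the value \<open>b\<close> at infinity is taken nowhere else,
      so the denominator is nonzero off \<open>P\<close>. The value 0 is the continuous extension to
      a pole of \<open>f\<close>.\<close>
    define k where "k z = (if z \<in> P then 0 else 1 / (f z - b))" for z
    have fb: "f z \<noteq> b" if "z \<notin> P" for z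
      using h_eq[OF that] inj[of "Some (pl z)" None] Some by (auto simp: b_def)
    have P_eq: "x = y" if "x \<in> P" "y \<in> P" for x y
      using that inj[of "Some (pl x)" "Some (pl y)"] by (auto simp: P_def)
    have f_inj: "x = y" if "x \<notin> P" "y \<notin> P" "f x = f y" for x y
      using h_eq[OF that(1)] h_eq[OF that(2)] inj[of "Some (pl x)" "Some (pl y)"] that(3) by auto
    have finP: "finite P"
      using P_eq by (metis finite.emptyI finite.insertI finite_subset insertI1 subsetI)
    have lim: "(k \<longlongrightarrow> k z) (at z)" if z: "z \<in> P" for z
    proof -
      define F where "F = in_charts id Inv h"
      have F: "conformal_at F (pl z)" "F (pl z) = 0"
        using z by (auto simp: F_def in_charts_def P_def intro: charts)
      then have "isCont F (pl z)"
        unfolding conformal_at_def using differentiable_imp_continuous_within by blast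
      moreover have "isCont pl z"
        using bounded_linear_pl linear_continuous_at by blast
      ultimately have "isCont (\<lambda>z. F (pl z)) z"
        using isCont_o2 by blast
      then have "isCont (\<lambda>z. cnj (cx (F (pl z)))) z"
        using bounded_linear.isCont[OF bounded_linear_cx] isCont_cnj by blast
      then have w: "((\<lambda>z. cnj (cx (F (pl z)))) \<longlongrightarrow> 0) (at z)"
        by (simp add: isCont_def F(2))
      \<comment> \<open>With w = 1 / f one has 1 / (f - b) = w / (1 - b w), and w tends to 0 at the
        pole. The chart \<open>Inv\<close> delivers the conjugate of w, which \<open>cnj\<close>
        undoes.\<close>
      have "((\<lambda>z. cnj (cx (F (pl z))) / (1 - b * cnj (cx (F (pl z))))) \<longlongrightarrow> 0 / (1 - b * 0)) (at z)"
        by (intro tendsto_intros w) simp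
      moreover have "\<forall>\<^sub>F x in at z. cnj (cx (F (pl x))) / (1 - b * cnj (cx (F (pl x)))) = k x"
      proof -
        \<comment> \<open>Zeros of \<open>f\<close> have to be avoided: there \<open>Inv\<close>
          gives infinity and \<open>F\<close> is meaningless.\<close>
        define Z where "Z = {x. x \<notin> P \<and> f x = 0}"
        have "finite Z"
        proof (cases "Z = {}")
          case False
          then obtain y where "y \<in> Z" by blast
          then have "Z \<subseteq> {y}" using f_inj by (auto simp: Z_def)
          then show ?thesis using finite_subset by blast
        qed simp
        moreover have "z \<notin> Z" using z by (simp add: Z_def)
        ultimately have "\<forall>\<^sub>F x in at z. x \<in> - Z"
          by (intro eventually_at_in_open' open_Compl finite_imp_closed) auto
        moreover have "\<forall>\<^sub>F x in at z. x \<noteq> z"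
          by (simp add: eventually_neq_at_within)
        ultimately show ?thesis
        proof eventually_elim
          case (elim x)
          then have x: "x \<notin> P" "f x \<noteq> 0"
            using P_eq z by (auto simp: Z_def)
          then have "F (pl x) = pl (1 / cnj (f x))"
            using Inv_Some_complex[of "pl (f x)"] h_eq[OF x(1)]
            by (simp add: F_def in_charts_def)
          with x show ?case
            using fb[OF x(1)] by (simp add: k_def field_simps)
        qed
      qed
      ultimately have "(k \<longlongrightarrow> 0) (at z)"
        by (simp add: tendsto_cong)
      then show ?thesis
        using z by (simp add: k_def[of z])
    qed
    have "(\<lambda>z. 1 / (f z - b)) holomorphic_on - P"
      by (intro holomorphic_intros hol) (use fb in auto)
    then have holk': "k holomorphic_on UNIV - P"
      unfolding Compl_eq_Diff_UNIV[symmetric] by (rule holomorphic_transform) (auto simp: k_def)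
    have holk: "k holomorphic_on UNIV"
      by (rule no_isolated_singularity'[OF lim holk' open_UNIV finP])
    define F where "F = in_charts Inv id h"
    have "conformal_at F 0" and F0: "F 0 = a"
      using Some by (auto simp: F_def in_charts_def intro: charts)
    then obtain c d where cd: "c > 0" "d > 0"
      "\<And>y. norm (y - 0) < d \<Longrightarrow> c * norm (y - 0) \<le> norm (F y - F 0)"
      using conformal_at_lower_bound by blast
    have "norm (k z) \<le> 1 / c * norm z" if z: "2 / d \<le> norm z" for z
    proof (cases "z \<in> P")
      case False
      obtain u where u: "norm u = 1 / norm z" "Inv (Some u) = Some (pl z)" "norm u < d"
        using inv_pt[OF z cd(2)] by blast
      have "norm z > 0" using z cd(2) by (smt (verit) divide_pos_pos)
      have "F u - F 0 = pl (f z - b)"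
        using h_eq[OF False] by (simp add: b_def F_def in_charts_def u(2) Some)
      then have "c / norm z \<le> norm (f z - b)"
        using cd(3)[of u] u by (metis diff_zero norm_pl times_divide_eq_right mult.right_neutral)
      moreover have "norm (f z - b) > 0" using fb[OF False] by simp
      ultimately have "1 / norm (f z - b) \<le> norm z / c"
        using cd(1) \<open>norm z > 0\<close> by (simp add: field_simps)
      then show ?thesis
        using False by (simp add: k_def norm_divide)
    qed (use cd in \<open>auto simp: k_def\<close>)
    then obtain \<alpha> \<beta> where ab: "\<And>z. k z = \<alpha> * z + \<beta>"
      using linear_growth_imp_affine[OF holk, of "2 / d" "1 / c"] by auto
    have "\<alpha> \<noteq> 0"
    proof
      assume "\<alpha> = 0"
      then have "k 0 = k 1" by (simp add: ab)
      \<comment> \<open>\<open>k\<close> vanishes exactly on \<open>P\<close>, so equal values leave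
        only these two alternatives; each contradicts injectivity.\<close>
      then have "0 \<in> P \<and> 1 \<in> P \<or> 0 \<notin> P \<and> 1 \<notin> P \<and> f 0 = f 1"
        using fb[of 0] fb[of 1] by (auto simp: k_def split: if_splits)
      then show False
        using P_eq[of 0 1] f_inj[of 0 1] by auto
    qed
    \<comment> \<open>Solving \<alpha> z + \<beta> = 1 / (f z - b) for f z gives these coefficients;
      their determinant is - \<alpha>.\<close>
    have "h x = mob (b * \<alpha>) (b * \<beta> + 1) \<alpha> \<beta> x" for x
    proof (cases x)
      case None
      then show ?thesis using Some \<open>\<alpha> \<noteq> 0\<close> by (simp add: mob_def b_def)
    next
      case (Some u)
      show ?thesis
      proof (cases "cx u \<in> P")
        case True
        then have "\<alpha> * cx u + \<beta> = 0" by (simp add: k_def flip: ab)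
        then show ?thesis using True Some by (simp add: mob_def P_def)
      next
        case False
        have k: "\<alpha> * cx u + \<beta> = 1 / (f (cx u) - b)"
          using False by (simp add: k_def flip: ab)
        have nz: "\<alpha> * cx u + \<beta> \<noteq> 0"
          unfolding k using fb[OF False] by simp
        have "b * \<alpha> * cx u + (b * \<beta> + 1) = b * (\<alpha> * cx u + \<beta>) + 1"
          by (simp add: algebra_simps)
        also have "\<dots> = f (cx u) * (\<alpha> * cx u + \<beta>)"
          unfolding k using fb[OF False] by (simp add: field_simps)
        finally show ?thesis
          using h_eq[OF False] nz Some by (simp add: mob_def)
      qed
    qed
    with \<open>\<alpha> \<noteq> 0\<close> show thesis
      by (intro that[of "b * \<alpha>" \<beta> "b * \<beta> + 1" \<alpha>]) (auto simp: algebra_simps)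
  qed
qed

section \<open>Consequences of square integrability\<close>

text \<open>The square of c / |u| has the same mass at every scale: the ball of radius
  \<open>R\<close> about \<open>3 R e\<close> has area of order R^2, and the integrand there is of
  order 1 / R^2. The tails of an integrable function tend to 0 instead. As \<open>R\<close> varies,
  these balls sweep out the cone.\<close>

lemma L2_on_cone_contradiction:
  fixes F :: "plane \<Rightarrow> plane"
  assumes L2: "\<And>j. L2_on E (\<lambda>x. F x $ j)" and "c > 0" "R\<^sub>0 > 0" and e: "norm e = 1"
    and low: "\<And>R u. R \<ge> R\<^sub>0 \<Longrightarrow> u \<in> ball ((3 * R) *\<^sub>R e) R \<Longrightarrow> u \<in> E \<and> c / norm u \<le> norm (F u)"
  shows False
proof -
  define G where "G u = indicator E u *\<^sub>R (norm (F u))\<^sup>2" for u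
  have "G = (\<lambda>u. indicator E u *\<^sub>R (F u $ 1)\<^sup>2 + indicator E u *\<^sub>R (F u $ 2)\<^sup>2)"
    by (simp add: G_def fun_eq_iff norm_plane algebra_simps)
  moreover have "integrable lebesgue (\<lambda>u. indicator E u *\<^sub>R (F u $ j)\<^sup>2)" for j
    using L2[of j] by (simp add: L2_on_def set_integrable_def)
  ultimately have G: "integrable lebesgue G"
    by simp
  have G_nonneg: "G u \<ge> 0" for u by (simp add: G_def)
  define T where "T n u = indicator {u. norm u > real n} u * G u" for n u
  have T_meas: "T n \<in> borel_measurable lebesgue" for n
  proof -
    have "{u::plane. norm u > real n} \<in> sets lebesgue"
      by (intro borel_open sets_completionI_sets[of _ lborel, simplified] open_Collect_less continuous_intros)
    then show ?thesis
      unfolding T_def by (intro borel_measurable_times borel_measurable_indicator) (use G in auto)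
  qed
  have T_int: "integrable lebesgue (T n)" for n
    by (rule Bochner_Integration.integrable_bound[OF G T_meas])
       (auto simp: T_def indicator_def G_nonneg)
  have "(\<lambda>n. integral\<^sup>L lebesgue (T n)) \<longlonglongrightarrow> integral\<^sup>L lebesgue (\<lambda>u::plane. 0)"
  proof (rule integral_dominated_convergence[where w = G])
    show "AE u in lebesgue. (\<lambda>n. T n u) \<longlonglongrightarrow> 0"
    proof (rule AE_I2)
      fix u :: plane
      have "\<forall>\<^sub>F n in sequentially. T n u = 0"
        using eventually_ge_at_top[of "nat \<lceil>norm u\<rceil>"]
      proof eventually_elim
        case (elim n)
        then have "norm u \<le> real n" by linarith
        then show ?case by (simp add: T_def indicator_def)
      qed
      then show "(\<lambda>n. T n u) \<longlonglongrightarrow> 0"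
        by (rule tendsto_eventually)
    qed
  qed (use T_meas G in \<open>auto simp: T_def indicator_def G_nonneg\<close>)
  then have lim: "(\<lambda>n. integral\<^sup>L lebesgue (T n)) \<longlonglongrightarrow> 0" by simp
  \<comment> \<open>On the ball |u| < 4 R, so the integrand is at least c^2 / (16 R^2); multiplied
    by the area of the ball this no longer depends on R.\<close>
  define K where "K = c\<^sup>2 / 16 * unit_ball_vol 2"
  have "K > 0" using \<open>c > 0\<close> by (simp add: K_def)
  have "K \<le> integral\<^sup>L lebesgue (T n)" if n: "real n \<ge> R\<^sub>0" for n
  proof -
    let ?R = "real n" and ?B = "ball ((3 * real n) *\<^sub>R e) (real n)"
    have R: "?R > 0" using n \<open>R\<^sub>0 > 0\<close> by simp
    have "K = integral\<^sup>L lebesgue (\<lambda>u. c\<^sup>2 / (16 * ?R\<^sup>2) * indicator ?B u)"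
      using R by (simp add: K_def content_ball)
    also have "\<dots> \<le> integral\<^sup>L lebesgue (T n)"
    proof (rule integral_mono[OF _ T_int])
      show "integrable lebesgue (\<lambda>u. c\<^sup>2 / (16 * ?R\<^sup>2) * indicator ?B u)"
        by (intro integrable_mult_right integrable_real_indicator) (use emeasure_lborel_ball_finite in \<open>auto\<close>)
      show "c\<^sup>2 / (16 * ?R\<^sup>2) * indicator ?B u \<le> T n u" for u
      proof (cases "u \<in> ?B")
        case True
        have n3: "norm ((3 * ?R) *\<^sub>R e) = 3 * ?R" using e by simp
        have "norm ((3 * ?R) *\<^sub>R e - u) < ?R" using True by (simp add: dist_norm)
        then have u: "norm u > ?R" "norm u < 4 * ?R"
          using n3 R norm_triangle_sub[of "(3 * ?R) *\<^sub>R e" u] norm_triangle_sub[of u "(3 * ?R) *\<^sub>R e"]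
          by (simp_all add: norm_minus_commute)
        have uE: "u \<in> E" "c / norm u \<le> norm (F u)" using low[OF n True] by auto
        have "c / (4 * ?R) \<le> c / norm u"
          using u \<open>c > 0\<close> R by (intro divide_left_mono mult_pos_pos) auto
        then have "(c / (4 * ?R))\<^sup>2 \<le> (norm (F u))\<^sup>2"
          using uE \<open>c > 0\<close> R by (intro power_mono) auto
        then show ?thesis
          using True u uE by (simp add: T_def G_def power_divide power_mult_distrib)
      qed (simp add: T_def G_nonneg)
    qed
    finally show ?thesis .
  qed
  then have "\<forall>\<^sub>F n in sequentially. K \<le> integral\<^sup>L lebesgue (T n)"
    using eventually_ge_at_top[of "nat \<lceil>R\<^sub>0\<rceil>"]
    by (auto elim!: eventually_mono simp: ceiling_le_iff nat_le_iff)
  then have "K \<le> 0"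
    using lim by (intro tendsto_lowerbound) auto
  with \<open>K > 0\<close> show False by simp
qed

text \<open>To first order |k x|^2 - 1 is 2 (k 0 . D x), which is 2 \<sigma> s (e . x) for a
  suitable unit vector \<open>e\<close>. In the cone about \<open>e\<close> this term dominates the
  errors, so \<open>k\<close> leaves the circle outwards for \<sigma> = 1 and inwards for \<sigma> =
  -1.\<close>

lemma conformal_at_cone:
  assumes k: "conformal_at k 0" "norm (k 0) = 1" and \<sigma>: "\<sigma> = 1 \<or> \<sigma> = (-1::real)"
  obtains e d where "norm e = 1" "d > 0"
    "\<And>x. 0 < norm x \<Longrightarrow> norm x < d \<Longrightarrow> norm x / 2 \<le> e \<bullet> x \<Longrightarrow> \<sigma> * ((norm (k x))\<^sup>2 - 1) > 0"
proof -
  obtain D s where D: "s > 0" "(k has_derivative D) (at 0)"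
    "\<And>v w. D v \<bullet> D w = s\<^sup>2 * (v \<bullet> w)" "\<And>v. norm (D v) = s * norm v"
    using conformal_at_bounds[OF k(1)] by metis
  have \<sigma>2: "\<sigma> * \<sigma> = 1" "\<bar>\<sigma>\<bar> = 1" using \<sigma> by auto
  have "linear D" using D(2) has_derivative_linear by blast
  moreover have "inj D"
    using \<open>linear D\<close> D(1,4) by (subst linear_injective_0) (auto, metis mult_eq_0_iff norm_eq_zero norm_zero order_less_irrefl)
  ultimately have "surj D" using linear_injective_imp_surjective by blast
  \<comment> \<open>The preimage of the outer or inner normal at \<open>k 0\<close>. Since
    \<open>D\<close> scales lengths by \<open>s\<close>, it is a unit vector.\<close>
  then obtain e where e: "D e = (\<sigma> * s) *\<^sub>R k 0" by (metis surjD)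
  have "s * norm e = s"
    using arg_cong[OF e, of norm] \<sigma>2 D(1) k(2) by (simp add: D(4) abs_mult)
  then have ne: "norm e = 1" using D(1) by simp
  have inn: "k 0 \<bullet> D x = \<sigma> * s * (e \<bullet> x)" for x
  proof -
    have "s * (\<sigma> * (k 0 \<bullet> D x)) = s * (s * (e \<bullet> x))"
      using D(3)[of e x] by (simp add: e power2_eq_square mult_ac)
    then have "\<sigma> * (k 0 \<bullet> D x) = s * (e \<bullet> x)" using D(1) by simp
    then have "\<sigma> * \<sigma> * (k 0 \<bullet> D x) = \<sigma> * (s * (e \<bullet> x))" by (simp only: mult.assoc)
    then show ?thesis using \<sigma>2 by (simp add: mult.assoc)
  qed
  obtain d where d: "d > 0" "\<And>y. norm (y - 0) < d \<Longrightarrow> norm (k y - k 0 - D (y - 0)) \<le> s/8 * norm (y - 0)"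
    using D(1,2) unfolding has_derivative_at_alt by (metis zero_less_divide_iff zero_less_numeral)
  show thesis
  \<comment> \<open>The remainder slope is \<open>s / 8\<close> and the radius gives s |x| < 1/2.
    Hence the errors stay below (1/4 + 81/128) s |x|, less than the main term, which is at least s
    |x| in the cone.\<close>
  proof (rule that[of e "min d (1 / (2 * s))"])
    fix x assume x: "0 < norm x" "norm x < min d (1 / (2 * s))" "norm x / 2 \<le> e \<bullet> x"
    define r where "r = k x - k 0 - D x"
    have r: "norm r \<le> s / 8 * norm x"
      using d(2)[of x] x by (simp add: r_def)
    have kx: "k x = k 0 + (D x + r)" by (simp add: r_def)
    have "(norm (k x))\<^sup>2 - 1 = 2 * (k 0 \<bullet> D x) + 2 * (k 0 \<bullet> r) + (norm (D x + r))\<^sup>2"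
      using k(2) unfolding kx by (simp add: power2_norm_eq_inner norm_eq_1 inner_add inner_commute)
    then have "\<sigma> * ((norm (k x))\<^sup>2 - 1) = 2 * (s * (e \<bullet> x)) + (2 * \<sigma> * (k 0 \<bullet> r) + \<sigma> * (norm (D x + r))\<^sup>2)"
      using \<sigma> by (auto simp: inn algebra_simps)
    moreover have "\<bar>2 * \<sigma> * (k 0 \<bullet> r)\<bar> \<le> s / 4 * norm x"
      using Cauchy_Schwarz_ineq2[of "k 0" r] r k(2) \<sigma>2 by (simp add: abs_mult)
    moreover have "\<bar>\<sigma> * (norm (D x + r))\<^sup>2\<bar> \<le> 81 / 64 * (s * norm x)\<^sup>2"
    proof -
      have "norm (D x + r) \<le> 9 / 8 * (s * norm x)"
        using norm_triangle_ineq[of "D x" r] r by (simp add: D(4))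
      then have "(norm (D x + r))\<^sup>2 \<le> (9 / 8 * (s * norm x))\<^sup>2" by (intro power_mono) auto
      then show ?thesis using \<sigma>2 by (simp add: abs_mult power_mult_distrib power_divide)
    qed
    moreover have "2 * (s * (e \<bullet> x)) \<ge> s * norm x"
      using x(3) D(1) by simp
    moreover have "(s * norm x)\<^sup>2 < 1/2 * (s * norm x)"
    proof -
      have "s * norm x < 1/2" using x(2) D(1) by (simp add: field_simps)
      then show ?thesis using x(1) D(1) unfolding power2_eq_square by (intro mult_strict_right_mono) auto
    qed
    moreover have "s * norm x > 0" using x D by simp
    ultimately show "\<sigma> * ((norm (k x))\<^sup>2 - 1) > 0"
      by (simp add: abs_le_iff)
  qed (use ne d D in auto)
qed

text \<open>Keeps \<open>h\<close> off the one value at which the target chart in use is undefined: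
  infinity for \<open>id\<close>, 0 for \<open>Inv\<close>.\<close>

lemma inj_punctured_nbhd_avoids:
  fixes H :: "plane \<Rightarrow> 'a"
  assumes "inj H"
  obtains d where "d > 0" "\<And>x. 0 < norm x \<Longrightarrow> norm x < d \<Longrightarrow> H x \<noteq> y"
proof (cases "\<exists>p. p \<noteq> 0 \<and> H p = y")
  case True
  then obtain p where "p \<noteq> 0" "H p = y" by blast
  with assms show thesis
    by (intro that[of "norm p"]) (auto simp: inj_def)
next
  case False
  then show thesis by (intro that[of 1]) auto
qed

text \<open>Inversion preserves directions, so it suffices that on the ball e . u >= 2 R while |u| <
  4 R. It links the balls at infinity with the cones at 0.\<close>

lemma inversion_of_ball_in_cone:
  fixes u e :: plane
  assumes "norm e = 1" "d > 0" "R > 0" "R \<ge> 1 / d" "u \<in> ball ((3 * R) *\<^sub>R e) R"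
  obtains x where "Inv (Some u) = Some x" "Inv (Some x) = Some u" "norm x = 1 / norm u"
    "0 < norm x" "norm x < d" "norm x / 2 \<le> e \<bullet> x" "2 * R < norm u"
proof -
  have n3: "norm ((3 * R) *\<^sub>R e) = 3 * R" using assms by simp
  have b: "norm ((3 * R) *\<^sub>R e - u) < R" using assms(5) by (simp add: dist_norm)
  have u: "norm u > 2 * R" "norm u < 4 * R"
    using b n3 norm_triangle_sub[of "(3 * R) *\<^sub>R e" u] norm_triangle_sub[of u "(3 * R) *\<^sub>R e"]
    by (simp_all add: norm_minus_commute)
  have u0: "u \<noteq> 0" using u assms by auto
  define x where "x = u /\<^sub>R (norm u)\<^sup>2"
  have x: "Inv (Some u) = Some x" using u0 by (simp add: x_def Inv.simps(2))
  have "e \<bullet> ((3 * R) *\<^sub>R e - u) \<le> R"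
    using Cauchy_Schwarz_ineq2[of e "(3 * R) *\<^sub>R e - u"] b assms(1) by simp
  then have "e \<bullet> u \<ge> 2 * R"
    using assms(1) by (simp add: inner_diff_right norm_eq_1)
  then have eu: "e \<bullet> u \<ge> norm u / 2" using u by simp
  show thesis
  proof (rule that[of x])
    show "Inv (Some x) = Some u" using x by (metis Inv_Inv)
    show nx: "norm x = 1 / norm u" using norm_Inv[OF x] .
    show "0 < norm x" using nx u0 by simp
    have "1 / norm u < 1 / R" using u assms(3) by (intro divide_strict_left_mono mult_pos_pos) auto
    also have "1 / R \<le> d" using assms by (simp add: field_simps)
    finally show "norm x < d" by (simp add: nx)
    have "e \<bullet> x = (e \<bullet> u) / (norm u)\<^sup>2" by (simp add: x_def divide_inverse)
    also have "\<dots> \<ge> (norm u / 2) / (norm u)\<^sup>2" using eu by (intro divide_right_mono) auto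
    finally show "norm x / 2 \<le> e \<bullet> x" using u0 by (simp add: nx power2_eq_square)
  qed (use x u in auto)
qed


text \<open>Infinity is not a point of \<Omega>, so only a value on the circle has to be excluded.
  In that case a cone at infinity is mapped into the disk, hence lies in \<Omega>, while |h| stays
  near 1 on it.\<close>

lemma W12_split_imp_inf_outside_cball:
  assumes into: "\<And>x. x \<in> Some ` \<Omega> \<longleftrightarrow> h x \<in> Some ` unit_disk"
    and conf: "conformal_mapping UNIV h"
    and W: "W12_split \<Omega> UNIV h"
  shows "h None \<notin> Some ` cball 0 1"
proof
  assume "h None \<in> Some ` cball 0 1"
  then obtain a where a: "h None = Some a" "norm a \<le> 1" by auto
  moreover have "h None \<notin> Some ` unit_disk" using into[of None] by auto
  ultimately have na: "norm a = 1" by (auto simp: image_iff)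
  have inj: "inj h" using conf by (simp add: conformal_mapping_def)
  define k where "k = in_charts Inv id h"
  have k: "conformal_at k 0" "k 0 = a"
    using conf a by (auto simp: k_def in_charts_def conformal_mapping_def plane_charts_def)
  then obtain e d where e: "norm e = 1" "d > 0"
    "\<And>x. 0 < norm x \<Longrightarrow> norm x < d \<Longrightarrow> norm x / 2 \<le> e \<bullet> x \<Longrightarrow> (- 1) * ((norm (k x))\<^sup>2 - 1) > 0"
    using conformal_at_cone[of k "- 1"] na by blast
  have "isCont k 0"
    using k unfolding conformal_at_def using differentiable_imp_continuous_within by blast
  then obtain d' where d': "d' > 0" "\<And>x. norm x < d' \<Longrightarrow> norm (k x - a) < 1/2"
    unfolding continuous_at_eps_delta using k(2) by (metis dist_norm diff_zero half_gt_zero zero_less_one)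
  have "inj (\<lambda>x. h (Inv (Some x)))"
    by (intro injI) (simp add: inj_eq[OF inj])
  then obtain d'' where d'': "d'' > 0" "\<And>x. 0 < norm x \<Longrightarrow> norm x < d'' \<Longrightarrow> h (Inv (Some x)) \<noteq> None"
    using inj_punctured_nbhd_avoids[of "\<lambda>x. h (Inv (Some x))" None] by metis
  define m where "m = Min {d, d', d''}"
  have m: "m > 0" "m \<le> d" "m \<le> d'" "m \<le> d''" using e d' d'' by (auto simp: m_def)
  show False
  \<comment> \<open>Close to \<open>a\<close> the modulus exceeds 1/2, and R >= 1 makes |u| >= 1, so
    1/2 dominates (1/2) / |u|.\<close>
  proof (rule L2_on_cone_contradiction[where F = "in_charts id id h" and E = "{u \<in> \<Omega>. Some u \<in> UNIV}"
        and c = "1/2" and R\<^sub>0 = "max 1 (1 / m)" and e = e])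
    show "L2_on {u \<in> \<Omega>. Some u \<in> UNIV} (\<lambda>x. in_charts id id h x $ j)" for j
      using W by (simp add: W12_split_def W12_on_def)
    fix R u assume R: "R \<ge> max 1 (1 / m)" and u: "u \<in> ball ((3 * R) *\<^sub>R e) R"
    obtain x where x: "Inv (Some u) = Some x" "Inv (Some x) = Some u" "norm x = 1 / norm u"
    "0 < norm x" "norm x < m" "norm x / 2 \<le> e \<bullet> x" "2 * R < norm u"
      using inversion_of_ball_in_cone[OF e(1) m(1) _ _ u] R by auto
    have hu: "h (Some u) = Some (k x)"
      using d''(2)[of x] x m by (auto simp: k_def in_charts_def)
    have "(norm (k x))\<^sup>2 < 1" using e(3)[of x] x m by simp
    then have "norm (k x) < 1" by (simp add: power_less_one_iff abs_square_less_1)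
    then have "u \<in> \<Omega>" using into[of "Some u"] hu by auto
    moreover have "norm u \<ge> 1" using x(7) R by simp
    then have "1 / 2 / norm u \<le> 1 / 2" by (simp add: divide_le_eq)
    moreover have "1 / 2 < norm (k x)"
      using d'(2)[of x] x m na norm_triangle_sub[of a "k x"] by (simp add: norm_minus_commute)
    ultimately show "u \<in> {u \<in> \<Omega>. Some u \<in> UNIV} \<and> 1 / 2 / norm u \<le> norm (in_charts id id h u)"
      by (simp add: in_charts_def hu)
  qed (use e in auto)
qed

text \<open>Points near 0 are far away in the coordinate \<open>Inv x\<close>. If 0 were outside
  \<Omega>, some cone at 0 would be mapped outside the disk, with |Inv (h x)| at least c |x|; this
  is decay like 1 / |u| in the inverted coordinate. The image of 0 may be infinity, on the circle or
  beyond it.\<close>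

lemma W12_split_imp_zero_mem:
  assumes into: "\<And>x. x \<in> Some ` \<Omega> \<longleftrightarrow> h x \<in> Some ` unit_disk"
    and conf: "conformal_mapping UNIV h"
    and W: "W12_split \<Omega> UNIV h"
  shows "0 \<in> \<Omega>"
proof (rule ccontr)
  assume "0 \<notin> \<Omega>"
  then have h0: "h (Some 0) \<notin> Some ` unit_disk" using into[of "Some 0"] by auto
  have inj: "inj h" using conf by (simp add: conformal_mapping_def)
  then have inj': "inj (\<lambda>x. h (Some x))" by (auto simp: inj_def)
  have "\<exists>e d c. norm e = 1 \<and> d > 0 \<and> c > 0 \<and> (\<forall>x. 0 < norm x \<and> norm x < d \<and> norm x / 2 \<le> e \<bullet> x \<longrightarrow>
          h (Some x) \<notin> Some ` unit_disk \<and> c * norm x \<le> norm (the (Inv (h (Some x)))))"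
  proof (cases "h (Some 0)")
    case None
    define k where "k = in_charts id Inv h"
    have k: "conformal_at k 0" "k 0 = 0"
      using conf None by (auto simp: k_def in_charts_def conformal_mapping_def plane_charts_def)
    obtain c d where cd: "c > 0" "d > 0" "\<And>y. norm (y - 0) < d \<Longrightarrow> c * norm (y - 0) \<le> norm (k y - k 0)"
      using conformal_at_lower_bound[OF k(1)] by blast
    have "isCont k 0"
      using k unfolding conformal_at_def using differentiable_imp_continuous_within by blast
    then obtain d' where d': "d' > 0" "\<And>x. norm x < d' \<Longrightarrow> norm (k x) < 1"
      unfolding continuous_at_eps_delta using k(2) by (metis dist_norm diff_zero zero_less_one)
    obtain d'' where d'': "d'' > 0" "\<And>x. 0 < norm x \<Longrightarrow> norm x < d'' \<Longrightarrow> h (Some x) \<noteq> Some 0"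
      using inj_punctured_nbhd_avoids[OF inj'] by metis
    have "h (Some x) \<notin> Some ` unit_disk \<and> c * norm x \<le> norm (the (Inv (h (Some x))))"
      if x: "0 < norm x" "norm x < Min {d, d', d''}" for x
    proof
      show "c * norm x \<le> norm (the (Inv (h (Some x))))"
        using cd(3)[of x] x k(2) by (simp add: k_def in_charts_def)
      show "h (Some x) \<notin> Some ` unit_disk"
      proof
        assume "h (Some x) \<in> Some ` unit_disk"
        then obtain y where y: "h (Some x) = Some y" "norm y < 1" by auto
        have "y \<noteq> 0" using d''(2)[of x] x y by auto
        then have "norm (k x) = 1 / norm y"
          using norm_Inv[of y "the (Inv (Some y))"] y by (simp add: k_def in_charts_def)
        then show False
          using d'(2)[of x] x y \<open>y \<noteq> 0\<close> by (simp add: divide_less_eq)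
      qed
    qed
    \<comment> \<open>A whole punctured neighbourhood works here, so the axis of the cone is
      arbitrary.\<close>
    then show ?thesis
      using cd d' d'' by (intro exI[of _ "axis 1 1"] exI[of _ "Min {d, d', d''}"] exI[of _ c]) auto
  next
    case (Some a)
    then have na: "norm a \<ge> 1" using h0 by (auto simp: image_iff)
    define k where "k = in_charts id id h"
    have k: "conformal_at k 0" "k 0 = a"
      using conf Some by (auto simp: k_def in_charts_def conformal_mapping_def plane_charts_def)
    have "isCont k 0"
      using k unfolding conformal_at_def using differentiable_imp_continuous_within by blast
    then have cont: "\<exists>d>0. \<forall>x. norm x < d \<longrightarrow> norm (k x - a) < \<epsilon>" if "\<epsilon> > 0" for \<epsilon>
      unfolding continuous_at_eps_delta using k(2) that by (metis dist_norm diff_zero)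
    obtain d'' where d'': "d'' > 0" "\<And>x. 0 < norm x \<Longrightarrow> norm x < d'' \<Longrightarrow> h (Some x) \<noteq> None"
      using inj_punctured_nbhd_avoids[OF inj'] by metis
    have "\<exists>e d. norm e = 1 \<and> d > 0 \<and> (\<forall>x. 0 < norm x \<and> norm x < d \<and> norm x / 2 \<le> e \<bullet> x \<longrightarrow> norm (k x) > 1)"
    proof (cases "norm a = 1")
      case True
      obtain e d where e: "norm e = 1" "d > 0"
        "\<And>x. 0 < norm x \<Longrightarrow> norm x < d \<Longrightarrow> norm x / 2 \<le> e \<bullet> x \<Longrightarrow> 1 * ((norm (k x))\<^sup>2 - 1) > 0"
        using conformal_at_cone[of k 1] k True by blast
      have "norm (k x) > 1" if "1 * ((norm (k x))\<^sup>2 - 1) > 0" for x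
        using that by (metis diff_gt_0_iff_gt mult_1 norm_ge_zero one_power2 power2_less_imp_less)
      with e show ?thesis by blast
    next
      case False
      with na obtain d where d: "d > 0" "\<And>x. norm x < d \<Longrightarrow> norm (k x - a) < norm a - 1"
        using cont[of "norm a - 1"] by auto
      have "norm (k x) > 1" if "norm x < d" for x
        using d(2)[OF that] norm_triangle_sub[of a "k x"] by (simp add: norm_minus_commute)
      then show ?thesis
        using d(1) by (intro exI[of _ "axis 1 1"] exI[of _ d]) auto
    qed
    then obtain e d where e: "norm e = 1" "d > 0"
      "\<And>x. 0 < norm x \<Longrightarrow> norm x < d \<Longrightarrow> norm x / 2 \<le> e \<bullet> x \<Longrightarrow> norm (k x) > 1"
      by blast
    obtain d' where d': "d' > 0" "\<And>x. norm x < d' \<Longrightarrow> norm (k x - a) < 1"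
      using cont[of 1] by auto
    \<comment> \<open>By continuity |h| < |a| + 1 near 0, so |Inv h| > c; with |x| < 1 this exceeds
      c |x|.\<close>
    define c where "c = 1 / (norm a + 1)"
    have "h (Some x) \<notin> Some ` unit_disk \<and> c * norm x \<le> norm (the (Inv (h (Some x))))"
      if x: "0 < norm x" "norm x < Min {d, d', d'', 1}" "norm x / 2 \<le> e \<bullet> x" for x
    proof -
      have hx: "h (Some x) = Some (k x)"
        using d''(2)[of x] x by (auto simp: k_def in_charts_def)
      have k1: "norm (k x) > 1" using e(3)[of x] x by simp
      have k2: "norm (k x) < norm a + 1"
        using d'(2)[of x] x norm_triangle_sub[of "k x" a] by simp
      have "k x \<noteq> 0" using k1 by auto
      then have "norm (the (Inv (h (Some x)))) = 1 / norm (k x)"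
        using norm_Inv[of "k x" "the (Inv (Some (k x)))"] hx by simp
      moreover have "c * norm x \<le> c * 1" using x by (intro mult_left_mono) (auto simp: c_def)
      moreover have "c \<le> 1 / norm (k x)"
        unfolding c_def using k1 k2 by (intro divide_left_mono mult_pos_pos) auto
      ultimately show ?thesis using hx k1 by auto
    qed
    moreover have "c > 0" by (simp add: c_def add_nonneg_pos)
    ultimately show ?thesis
      using e d' d'' by (intro exI[of _ e] exI[of _ "Min {d, d', d'', 1}"] exI[of _ c]) auto
  qed
  then obtain e d c where e: "norm e = 1" "d > 0" "c > 0"
    "\<And>x. 0 < norm x \<Longrightarrow> norm x < d \<Longrightarrow> norm x / 2 \<le> e \<bullet> x \<Longrightarrow>
          h (Some x) \<notin> Some ` unit_disk \<and> c * norm x \<le> norm (the (Inv (h (Some x))))"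
    by blast
  define E where "E = {u. Inv (Some u) \<in> UNIV - Some ` \<Omega>}"
  have *: "u \<in> E \<and> c / norm u \<le> norm (in_charts Inv Inv h u)"
    if R: "R \<ge> 1 / d" and u: "u \<in> ball ((3 * R) *\<^sub>R e) R" for R u
  proof -
    have "R > 0" using R e(2) by (smt (verit) divide_pos_pos)
    then obtain x where x: "Inv (Some u) = Some x" "norm x = 1 / norm u"
    "0 < norm x" "norm x < d" "norm x / 2 \<le> e \<bullet> x"
      using inversion_of_ball_in_cone[OF e(1,2) _ R u] by metis
    have "Some x \<notin> Some ` \<Omega>" using into[of "Some x"] e(4)[of x] x by auto
    then show ?thesis
      using e(4)[of x] x by (simp add: E_def in_charts_def)
  qed
  show False
  proof (rule L2_on_cone_contradiction[where F = "in_charts Inv Inv h" and E = "interior E"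
        and c = c and R\<^sub>0 = "1 / d" and e = e])
    show "L2_on (interior E) (\<lambda>x. in_charts Inv Inv h x $ j)" for j
      using W by (simp add: W12_split_def W12_on_def E_def)
    fix R u assume R: "R \<ge> 1 / d" and u: "u \<in> ball ((3 * R) *\<^sub>R e) R"
    \<comment> \<open>\<open>W12_split\<close> integrates over the interior only; the balls are
      open, so they lie in it.\<close>
    have "ball ((3 * R) *\<^sub>R e) R \<subseteq> interior E"
      using *[OF R] by (intro interior_maximal) auto
    then show "u \<in> interior E \<and> c / norm u \<le> norm (in_charts Inv Inv h u)"
      using *[OF R u] u by blast
  qed (use e in auto)
qed

section \<open>Harmonicity of holomorphic maps\<close>

lemma partial_eq: "(F has_derivative D) (at x) \<Longrightarrow> partial i F x = D (axis i 1)"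
  unfolding partial_def by (drule frechet_derivative_at) simp

lemma partial_cong_open:
  assumes "open U" "x \<in> U" "\<And>u. u \<in> U \<Longrightarrow> f u = g u"
  shows "partial i f x = partial i g x"
proof -
  have "(f has_derivative D) (at x) \<longleftrightarrow> (g has_derivative D) (at x)" for D
    using has_derivative_transform_within_open[OF _ assms(1,2), where f = f and g = g]
      has_derivative_transform_within_open[OF _ assms(1,2), where f = g and g = f] assms(3) by auto
  then show ?thesis by (simp add: partial_def frechet_derivative_def)
qed

lemma Ck_on_cong_open:
  assumes "open U" "\<And>u. u \<in> U \<Longrightarrow> f u = g u"
  shows "Ck_on k U f \<longleftrightarrow> Ck_on k U g"
  using assms(2)
proof (induction k arbitrary: f g)
  case 0
  then show ?case by (auto cong: continuous_on_cong)
next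
  case (Suc k)
  have "f differentiable_on U \<longleftrightarrow> g differentiable_on U"
    using Suc.prems
    by (auto simp: differentiable_on_def intro: differentiable_transform_within[where d = 1])
  moreover have "Ck_on k U (partial i f) \<longleftrightarrow> Ck_on k U (partial i g)" for i
    by (rule Suc.IH) (use assms(1) Suc.prems in \<open>auto intro: partial_cong_open\<close>)
  ultimately show ?case by simp
qed

lemma laplacian_cong_open:
  assumes "open U" "x \<in> U" "\<And>u. u \<in> U \<Longrightarrow> f u = g u"
  shows "laplacian f x = laplacian g x"
  unfolding laplacian_def
  by (intro sum.cong refl partial_cong_open[OF assms(1,2)] partial_cong_open[OF assms(1) _ assms(3)])

lemma solves_laplace_on_cong_open:
  assumes "open U" "\<And>u. u \<in> U \<Longrightarrow> f u = g u"
  shows "solves_laplace_on U f \<longleftrightarrow> solves_laplace_on U g"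
  unfolding solves_laplace_on_def
  using Ck_on_cong_open[OF assms] laplacian_cong_open[OF assms(1) _ assms(2)] by auto

lemma holomorphic_has_derivative_plane:
  assumes "f holomorphic_on S" "open S" "cx x \<in> S"
  shows "((\<lambda>u. pl (f (cx u))) has_derivative (\<lambda>v. pl (deriv f (cx x) * cx v))) (at x)"
proof -
  have "(f has_derivative (*) (deriv f (cx x))) (at (cx x))"
    using holomorphic_derivI[OF assms] by (simp add: has_field_derivative_def)
  then show ?thesis
    by (intro has_derivative_pl has_derivative_compose[OF bounded_linear_imp_has_derivative[OF bounded_linear_cx]])
qed

text \<open>The factor \<open>cx (axis i 1)\<close> is 1 or the imaginary unit. A partial derivative
  is thus again a holomorphic function in plane coordinates, which allows iteration.\<close>

lemma partial_holomorphic: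
  assumes "f holomorphic_on S" "open S" "cx x \<in> S"
  shows "partial i (\<lambda>u. pl (f (cx u))) x = pl (cx (axis i 1) * deriv f (cx x))"
  using partial_eq[OF holomorphic_has_derivative_plane[OF assms]] by (simp add: mult.commute)

lemma open_vimage_cx: "open S \<Longrightarrow> open (cx -` S)"
  by (intro open_vimage) (auto intro!: continuous_intros)

lemma Ck_on_holomorphic:
  assumes "f holomorphic_on S" "open S"
  shows "Ck_on k (cx -` S) (\<lambda>u. pl (f (cx u)))"
  using assms(1)
proof (induction k arbitrary: f)
  case 0
  then have "continuous_on S f" by (rule holomorphic_on_imp_continuous_on)
  then have "continuous_on (cx -` S) (\<lambda>u. f (cx u))"
    by (rule continuous_on_compose2) (auto intro!: continuous_intros)
  then show ?case by (auto intro!: continuous_intros)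
next
  case (Suc k)
  have "Ck_on k (cx -` S) (partial i (\<lambda>u. pl (f (cx u))))" for i
  proof -
    have "Ck_on k (cx -` S) (\<lambda>u. pl ((\<lambda>z. cx (axis i 1) * deriv f z) (cx u)))"
      by (rule Suc.IH) (intro holomorphic_intros Suc.prems assms)
    then show ?thesis
      by (subst Ck_on_cong_open[OF open_vimage_cx[OF assms(2)]])
         (use partial_holomorphic[OF Suc.prems assms(2)] in auto)
  qed
  moreover have "(\<lambda>u. pl (f (cx u))) differentiable_on cx -` S"
    unfolding differentiable_on_eq_differentiable_at[OF open_vimage_cx[OF assms(2)]]
    using holomorphic_has_derivative_plane[OF Suc.prems assms(2)] by (auto simp: differentiable_def)
  ultimately show ?case by simp
qed

text \<open>The second partials are f'' times 1^2 and times \<i>^2, which cancel.\<close>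

lemma laplacian_holomorphic:
  assumes "f holomorphic_on S" "open S" "cx x \<in> S"
  shows "laplacian (\<lambda>u. pl (f (cx u))) x = 0"
proof -
  have "partial i (partial i (\<lambda>u. pl (f (cx u)))) x =
      pl (cx (axis i 1) * (cx (axis i 1) * deriv (deriv f) (cx x)))" for i
  proof -
    have hol: "deriv f holomorphic_on S" "(\<lambda>z. cx (axis i 1) * deriv f z) holomorphic_on S"
      by (intro holomorphic_intros assms)+
    have "partial i (partial i (\<lambda>u. pl (f (cx u)))) x =
        partial i (\<lambda>u. pl ((\<lambda>z. cx (axis i 1) * deriv f z) (cx u))) x"
      by (rule partial_cong_open[OF open_vimage_cx[OF assms(2)]])
         (use assms partial_holomorphic[OF assms(1,2)] in auto)
    also have "\<dots> = pl (cx (axis i 1) * deriv (\<lambda>z. cx (axis i 1) * deriv f z) (cx x))"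
      using partial_holomorphic[OF hol(2) assms(2,3)] .
    also have "deriv (\<lambda>z. cx (axis i 1) * deriv f z) (cx x) = cx (axis i 1) * deriv (deriv f) (cx x)"
      using hol(1) assms by (intro deriv_cmult) (meson holomorphic_on_imp_differentiable_at)
    finally show ?thesis .
  qed
  moreover have "cx (axis 1 1) = 1" "cx (axis 2 1) = \<i>"
    by (simp_all add: complex_eq_iff)
  ultimately show ?thesis
    by (simp add: laplacian_def sum_2 vec_eq_iff forall_2)
qed

lemma solves_laplace_on_holomorphic:
  assumes "f holomorphic_on S" "open S" "U \<subseteq> cx -` S" "open U"
  shows "solves_laplace_on U (\<lambda>u. pl (f (cx u)))"
proof -
  have mono: "Ck_on k V g \<Longrightarrow> W \<subseteq> V \<Longrightarrow> Ck_on k W g" for k V W and g :: "plane \<Rightarrow> plane"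
    by (induction k arbitrary: g) (auto intro: continuous_on_subset differentiable_on_subset)
  show ?thesis
    unfolding solves_laplace_on_def
    using mono[OF Ck_on_holomorphic[OF assms(1,2), of 2] assms(3)] laplacian_holomorphic[OF assms(1,2)] assms(3)
    by auto
qed

section \<open>Uniqueness for the Dirichlet problem\<close>

text \<open>The first derivative vanishes at the maximum; if \<open>c\<close> were positive it would
  be positive just to the right, and the mean value theorem would give a larger value there.\<close>

lemma second_derivative_nonpos_at_max:
  fixes \<phi> :: "real \<Rightarrow> real"
  assumes "d > 0" "\<And>t. \<bar>t\<bar> < d \<Longrightarrow> (\<phi> has_real_derivative \<phi>' t) (at t)"
    and "(\<phi>' has_real_derivative c) (at 0)" "\<And>t. \<bar>t\<bar> < d \<Longrightarrow> \<phi> t \<le> \<phi> 0"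
  shows "c \<le> 0"
proof (rule ccontr)
  assume "\<not> c \<le> 0"
  have "\<phi>' 0 = 0"
    by (rule DERIV_local_max[of \<phi> _ 0 d]) (use assms in auto)
  then obtain \<delta> where \<delta>: "\<delta> > 0" "\<And>t. 0 < t \<Longrightarrow> t < \<delta> \<Longrightarrow> \<phi>' t > 0"
    using DERIV_pos_inc_right[OF assms(3)] \<open>\<not> c \<le> 0\<close> by auto
  define t where "t = min d \<delta> / 2"
  have t: "0 < t" "t < d" "t < \<delta>" using assms(1) \<delta>(1) by (auto simp: t_def)
  obtain z where z: "0 < z" "z < t" "\<phi> t - \<phi> 0 = (t - 0) * \<phi>' z"
    using MVT2[of 0 t \<phi> \<phi>'] assms(2) t by (smt (verit))
  then have "\<phi> t - \<phi> 0 > 0"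
    using \<delta>(2)[of z] t by simp
  then show False using assms(4)[of t] t by simp
qed

lemma has_derivative_along_axis:
  fixes f :: "plane \<Rightarrow> real"
  assumes "f differentiable (at (x + t *\<^sub>R axis i 1))"
  shows "((\<lambda>t. f (x + t *\<^sub>R axis i 1)) has_real_derivative partial i f (x + t *\<^sub>R axis i 1)) (at t)"
proof -
  let ?D = "frechet_derivative f (at (x + t *\<^sub>R axis i 1))"
  have D: "(f has_derivative ?D) (at (x + t *\<^sub>R axis i 1))"
    using assms frechet_derivative_works by blast
  have "((\<lambda>t. x + t *\<^sub>R axis i 1) has_derivative (\<lambda>h. h *\<^sub>R axis i 1)) (at t)"
    by (auto intro!: derivative_eq_intros)
  from has_derivative_compose[OF this D]
  have "((\<lambda>t. f (x + t *\<^sub>R axis i 1)) has_derivative (\<lambda>h. ?D (h *\<^sub>R axis i 1))) (at t)" .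
  moreover have "?D (h *\<^sub>R axis i 1) = partial i f (x + t *\<^sub>R axis i 1) * h" for h
    using linear_scale[OF has_derivative_linear[OF D]] by (simp add: partial_def)
  ultimately show ?thesis
    by (simp add: has_field_derivative_def)
qed

text \<open>Adding \<epsilon> |x|^2 raises the Laplacian to 4 \<epsilon> > 0, which is impossible at
  an interior maximum, where both pure second derivatives are nonpositive.\<close>

lemma harmonic_max_principle:
  fixes w :: "plane \<Rightarrow> real"
  assumes cont: "continuous_on (cball 0 1) w"
    and d1: "\<And>x. norm x < 1 \<Longrightarrow> w differentiable (at x)"
    and d2: "\<And>x i. norm x < 1 \<Longrightarrow> partial i w differentiable (at x)"
    and lap: "\<And>x. norm x < 1 \<Longrightarrow> laplacian w x = 0"
    and bd: "\<And>x. norm x = 1 \<Longrightarrow> w x \<le> 0"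
    and x0: "norm x\<^sub>0 < 1"
  shows "w x\<^sub>0 \<le> 0"
proof (rule ccontr)
  assume "\<not> w x\<^sub>0 \<le> 0"
  \<comment> \<open>Half the supposed positive value: on the circle \<open>q\<close> is at most
    \<epsilon>, which is below its value at \<open>x\<^sub>0\<close>, so the maximum is
    interior.\<close>
  define \<epsilon> where "\<epsilon> = w x\<^sub>0 / 2"
  have \<epsilon>: "\<epsilon> > 0" "w x\<^sub>0 > \<epsilon>" using \<open>\<not> w x\<^sub>0 \<le> 0\<close> by (auto simp: \<epsilon>_def)
  define q where "q x = w x + \<epsilon> * (x \<bullet> x)" for x
  have "continuous_on (cball 0 1) q"
    unfolding q_def by (intro continuous_intros cont)
  then obtain x1 where x1: "norm x1 \<le> 1" "\<And>y. norm y \<le> 1 \<Longrightarrow> q y \<le> q x1"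
    using continuous_attains_sup[of "cball 0 1" q] by auto
  have "q x1 > \<epsilon>"
    using x1(2)[of x\<^sub>0] x0 \<epsilon> inner_ge_zero[of x\<^sub>0] by (smt (verit) q_def mult_nonneg_nonneg)
  have "norm x1 \<noteq> 1"
  proof
    assume "norm x1 = 1"
    then have "q x1 \<le> \<epsilon>" using bd[of x1] by (simp add: q_def norm_eq_1)
    with \<open>q x1 > \<epsilon>\<close> show False by simp
  qed
  with x1 have n1: "norm x1 < 1" by simp
  have "partial i (partial i w) x1 + 2 * \<epsilon> \<le> 0" for i
  proof (rule second_derivative_nonpos_at_max)
    let ?e = "axis i 1 :: plane"
    have lt: "norm (x1 + t *\<^sub>R ?e) < 1" if "\<bar>t\<bar> < 1 - norm x1" for t
      using norm_triangle_ineq[of x1 "t *\<^sub>R ?e"] that by simp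
    have ee: "?e \<bullet> ?e = 1" by (simp add: inner_axis)
    show "1 - norm x1 > 0" using n1 by simp
    show "((\<lambda>t. q (x1 + t *\<^sub>R ?e)) has_real_derivative
        partial i w (x1 + t *\<^sub>R ?e) + 2 * \<epsilon> * (x1 \<bullet> ?e + t)) (at t)"
      if "\<bar>t\<bar> < 1 - norm x1" for t
    proof -
      have "(\<lambda>t. q (x1 + t *\<^sub>R ?e)) = (\<lambda>t. w (x1 + t *\<^sub>R ?e) + \<epsilon> * (x1 \<bullet> x1 + 2 * t * (x1 \<bullet> ?e) + t\<^sup>2))"
        by (simp add: q_def fun_eq_iff inner_add inner_commute ee power2_eq_square)
      then show ?thesis
        by (auto intro!: derivative_eq_intros has_derivative_along_axis d1 lt that simp: algebra_simps)
    qed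
    have "((\<lambda>t. partial i w (x1 + t *\<^sub>R ?e)) has_real_derivative partial i (partial i w) (x1 + 0 *\<^sub>R ?e)) (at 0)"
      by (rule has_derivative_along_axis) (use d2 n1 in auto)
    then show "((\<lambda>t. partial i w (x1 + t *\<^sub>R ?e) + 2 * \<epsilon> * (x1 \<bullet> ?e + t)) has_real_derivative
        partial i (partial i w) x1 + 2 * \<epsilon>) (at 0)"
      by (auto intro!: derivative_eq_intros)
    show "q (x1 + t *\<^sub>R ?e) \<le> q (x1 + 0 *\<^sub>R ?e)" if "\<bar>t\<bar> < 1 - norm x1" for t
      using x1(2)[of "x1 + t *\<^sub>R ?e"] lt[OF that] by simp
  qed
  from this[of 1] this[of 2] show False
    using lap[OF n1] \<epsilon>(1) by (simp add: laplacian_def sum_2)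
qed

lemma partial_component_diff:
  fixes u v :: "plane \<Rightarrow> plane"
  assumes "u differentiable (at x)" "v differentiable (at x)"
  shows "(\<lambda>x. (u x - v x) $ j) differentiable (at x)"
    "partial i (\<lambda>x. (u x - v x) $ j) x = (partial i u x - partial i v x) $ j"
proof -
  have "((\<lambda>x. (u x - v x) $ j) has_derivative
      (\<lambda>h. (frechet_derivative u (at x) h - frechet_derivative v (at x) h) $ j)) (at x)"
    using assms unfolding frechet_derivative_works
    by (intro bounded_linear.has_derivative[OF bounded_linear_vec_nth] has_derivative_diff)
  then show "(\<lambda>x. (u x - v x) $ j) differentiable (at x)"
    "partial i (\<lambda>x. (u x - v x) $ j) x = (partial i u x - partial i v x) $ j"
    using partial_eq by (auto simp: differentiable_def partial_def)
qed

lemma Ck_on_2_ballD: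
  fixes u :: "plane \<Rightarrow> plane"
  assumes "Ck_on 2 (ball 0 1) u" "norm x < 1"
  shows "u differentiable (at x)" "partial i u differentiable (at x)"
  using assms by (simp_all add: numeral_2_eq_2 differentiable_on_eq_differentiable_at)

text \<open>The maximum principle applied to one component of \<open>u - v\<close>; exchanging the
  roles of \<open>u\<close> and \<open>v\<close> then gives uniqueness.\<close>

lemma dirichlet_solution_le:
  assumes u: "dirichlet_solution b u" and v: "dirichlet_solution b v" and x: "norm x < 1"
  shows "u x $ j \<le> v x $ j"
proof -
  have C: "Ck_on 2 unit_disk u" "Ck_on 2 unit_disk v"
    using u v by (auto simp: dirichlet_solution_def solves_laplace_on_def)
  define w where "w x = (u x - v x) $ j" for x
  \<comment> \<open>The partials of \<open>w\<close> equal \<open>dw\<close> only inside the disk,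
    so differentiating again relies on the disk being open.\<close>
  define dw where "dw i x = (partial i u x - partial i v x) $ j" for i x
  have w1: "w differentiable (at x)" "partial i w x = dw i x" if "norm x < 1" for x i
    unfolding w_def dw_def
    using partial_component_diff[OF Ck_on_2_ballD(1)[OF C(1) that] Ck_on_2_ballD(1)[OF C(2) that]]
    by auto
  have w2: "dw i differentiable (at x)"
    "partial i (dw i) x = (partial i (partial i u) x - partial i (partial i v) x) $ j" if "norm x < 1" for x i
    unfolding dw_def
    using partial_component_diff[OF Ck_on_2_ballD(2)[OF C(1) that] Ck_on_2_ballD(2)[OF C(2) that]]
    by auto
  have w3: "partial i w differentiable (at x)" if "norm x < 1" for x i
    using w2(1)[OF that, of i] unfolding differentiable_def
    by (metis (no_types, lifting) has_derivative_transform_within_open open_ball mem_ball_0 that w1(2))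
  have w4: "partial i (partial i w) x = partial i (dw i) x" if "norm x < 1" for x i
    by (rule partial_cong_open[of unit_disk]) (use that w1 in auto)
  have "w x \<le> 0"
  proof (rule harmonic_max_principle[OF _ w1(1) w3 _ _ x])
    show "continuous_on (cball 0 1) w"
      unfolding w_def using u v by (intro continuous_intros) (auto simp: dirichlet_solution_def)
    show "laplacian w x = 0" if "norm x < 1" for x
    proof -
      have "laplacian w x = (laplacian u x - laplacian v x) $ j"
        using that by (simp add: laplacian_def sum_2 w4 w2(2))
      also have "\<dots> = 0"
        using u v that by (simp add: dirichlet_solution_def solves_laplace_on_def)
      finally show ?thesis .
    qed
    show "w x \<le> 0" if "norm x = 1" for x
    proof -
      have "Some (u x) = Some (v x)"
        using u v that by (simp add: dirichlet_solution_def)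
      then show ?thesis by (simp add: w_def)
    qed
  qed
  then show ?thesis by (simp add: w_def)
qed

lemma dirichlet_solution_imp_determined:
  assumes "dirichlet_solution b u" "\<And>y. y \<in> unit_disk \<Longrightarrow> u y = G y"
  shows "determined_by_laplace b G"
  unfolding determined_by_laplace_def
proof (intro conjI allI impI ballI)
  fix v y assume v: "dirichlet_solution b v" and y: "y \<in> unit_disk"
  have "v y $ j = u y $ j" for j
    using dirichlet_solution_le[OF assms(1) v, of y j] dirichlet_solution_le[OF v assms(1), of y j] y
    by simp
  then show "v y = G y"
    using assms(2)[OF y] by (simp add: vec_eq_iff)
qed (use assms in blast)

section \<open>Sobolev regularity\<close>

lemma continuous_on_cball_set_integrable:
  fixes p :: "plane \<Rightarrow> real"
  assumes "continuous_on (cball 0 1) p"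
  shows "set_integrable lebesgue unit_disk p"
proof -
  have "integrable lborel (\<lambda>x. indicator (cball 0 1) x *\<^sub>R p x)"
    by (rule borel_integrable_compact) (use assms in auto)
  then have "set_integrable lebesgue (cball 0 1) p"
    unfolding set_integrable_def by (subst integrable_completion) auto
  then show ?thesis
    by (rule set_integrable_subset) auto
qed

lemma continuous_on_cball_L2_on:
  assumes "continuous_on (cball 0 1) p"
  shows "L2_on unit_disk p"
proof -
  have "continuous_on unit_disk p" using assms by (rule continuous_on_subset) auto
  then have "(\<lambda>x. indicator unit_disk x *\<^sub>R p x) \<in> borel_measurable borel"
    by (intro borel_measurable_continuous_on_indicator) auto
  then have "set_borel_measurable lebesgue unit_disk p"
    unfolding set_borel_measurable_def by (intro measurable_completion) simp
  then show ?thesis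
    unfolding L2_on_def
    by (intro conjI continuous_on_cball_set_integrable continuous_intros assms)
qed

lemma integral_translate_lborel:
  fixes \<psi> :: "plane \<Rightarrow> real"
  assumes "\<psi> \<in> borel_measurable borel" "integrable lborel \<psi>"
  shows "integrable lborel (\<lambda>x. \<psi> (c + x))" "(\<integral>x. \<psi> (c + x) \<partial>lborel) = (\<integral>x. \<psi> x \<partial>lborel)"
proof -
  have c: "(+) c \<in> measurable lborel borel" by simp
  show "integrable lborel (\<lambda>x. \<psi> (c + x))"
    using assms integrable_distr_eq[OF c assms(1)] by (simp add: lborel_distr_plus)
  show "(\<integral>x. \<psi> (c + x) \<partial>lborel) = (\<integral>x. \<psi> x \<partial>lborel)"
    using integral_distr[OF c assms(1)] by (simp add: lborel_distr_plus)
qed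

text \<open>Integrals of difference quotients vanish by translation invariance, and dominated convergence
  passes this on to the partial derivative.\<close>

lemma integral_partial_eq_0:
  fixes \<psi> :: "plane \<Rightarrow> real"
  assumes diff: "\<And>x. \<psi> differentiable (at x)" and cont: "continuous_on UNIV (partial i \<psi>)"
    and zero: "\<And>x. norm x \<ge> 1 \<Longrightarrow> \<psi> x = 0"
  shows "(\<integral>x. partial i \<psi> x \<partial>lborel) = 0"
proof -
  let ?e = "axis i 1 :: plane"
  have contp: "continuous_on UNIV \<psi>"
    using diff by (simp add: continuous_on_eq_continuous_at differentiable_imp_continuous_within)
  have meas: "\<psi> \<in> borel_measurable borel" "partial i \<psi> \<in> borel_measurable borel"
    using contp cont by (auto intro: borel_measurable_continuous_onI)
  have "integrable lborel (\<lambda>x. indicator (cball 0 1) x *\<^sub>R \<psi> x)"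
    by (rule borel_integrable_compact) (auto intro: continuous_on_subset[OF contp])
  also have "(\<lambda>x. indicator (cball 0 1) x *\<^sub>R \<psi> x) = \<psi>"
    using zero by (auto simp: fun_eq_iff indicator_def)
  finally have int: "integrable lborel \<psi>" .
  \<comment> \<open>Locality needs an open set, so the circle is left out; there the bound
    \<open>M\<close> from the closed disk applies.\<close>
  have pz: "partial i \<psi> x = 0" if "norm x > 1" for x
  proof -
    have "partial i \<psi> x = partial i (\<lambda>x. 0) x"
      by (rule partial_cong_open[of "- cball 0 1"]) (use that zero in auto)
    also have "\<dots> = 0" by (rule partial_eq) (rule has_derivative_const)
    finally show ?thesis .
  qed
  have "bounded (partial i \<psi> ` cball 0 1)"
    by (intro compact_imp_bounded compact_continuous_image continuous_on_subset[OF cont]) auto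
  then obtain M where M: "M \<ge> 0" "\<And>x. norm x \<le> 1 \<Longrightarrow> \<bar>partial i \<psi> x\<bar> \<le> M"
    unfolding bounded_pos by (metis image_eqI less_imp_le mem_cball_0 real_norm_def)
  have M': "\<bar>partial i \<psi> x\<bar> \<le> M" for x
    using M pz[of x] by (cases "norm x \<le> 1") auto
  define s where "s n x = (\<psi> ((1 / Suc n) *\<^sub>R ?e + x) - \<psi> x) * Suc n" for n x
  have s_int: "integral\<^sup>L lborel (s n) = 0" for n
    unfolding s_def using integral_translate_lborel[OF meas(1) int] int by simp
  have "(\<lambda>n. integral\<^sup>L lborel (s n)) \<longlonglongrightarrow> integral\<^sup>L lborel (partial i \<psi>)"
  \<comment> \<open>The mean value theorem bounds every quotient by \<open>M\<close>. Steps of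
    length at most 1 cannot reach the unit disk from outside radius 2.\<close>
  proof (rule integral_dominated_convergence[where w = "\<lambda>x. indicator (cball 0 2) x *\<^sub>R M"])
    show "partial i \<psi> \<in> borel_measurable lborel" using meas by simp
    show "s n \<in> borel_measurable lborel" for n
      unfolding s_def using meas(1) by measurable
    show "integrable lborel (\<lambda>x::plane. indicator (cball 0 2) x *\<^sub>R M)"
      by (rule borel_integrable_compact) auto
    show "AE x in lborel. (\<lambda>n. s n x) \<longlonglongrightarrow> partial i \<psi> x"
    proof (rule AE_I2)
      fix x
      have "((\<lambda>t. \<psi> (x + t *\<^sub>R ?e)) has_real_derivative partial i \<psi> (x + 0 *\<^sub>R ?e)) (at 0)"
        by (rule has_derivative_along_axis[OF diff])
      then have "((\<lambda>h. (\<psi> (x + h *\<^sub>R ?e) - \<psi> x) / h) \<longlongrightarrow> partial i \<psi> x) (at 0)"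
        by (simp add: has_field_derivative_def DERIV_def[unfolded has_field_derivative_def])
      moreover have "filterlim (\<lambda>n. 1 / real (Suc n)) (at 0) sequentially"
        unfolding filterlim_at using LIMSEQ_Suc[OF lim_1_over_n] by auto
      ultimately have "(\<lambda>n. (\<psi> (x + (1 / real (Suc n)) *\<^sub>R ?e) - \<psi> x) / (1 / real (Suc n))) \<longlonglongrightarrow> partial i \<psi> x"
        by (rule filterlim_compose)
      then show "(\<lambda>n. s n x) \<longlonglongrightarrow> partial i \<psi> x"
        by (simp add: s_def add.commute)
    qed
    show "AE x in lborel. norm (s n x) \<le> indicator (cball 0 2) x *\<^sub>R M" for n
    proof (rule AE_I2)
      fix x :: plane
      let ?t = "1 / real (Suc n)"
      have t: "?t > 0" "?t \<le> 1" by auto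
      show "norm (s n x) \<le> indicator (cball 0 2) x *\<^sub>R M"
      proof (cases "norm x \<le> 2")
        case True
        obtain z where z: "\<psi> (x + ?t *\<^sub>R ?e) - \<psi> (x + 0 *\<^sub>R ?e) = (?t - 0) * partial i \<psi> (x + z *\<^sub>R ?e)"
          using MVT2[of 0 ?t "\<lambda>t. \<psi> (x + t *\<^sub>R ?e)" "\<lambda>t. partial i \<psi> (x + t *\<^sub>R ?e)", OF t(1)
              has_derivative_along_axis[OF diff]] by blast
        then have "s n x = partial i \<psi> (x + z *\<^sub>R ?e)"
          by (simp add: s_def add.commute)
        then show ?thesis using M' True by simp
      next
        case False
        have "norm x - ?t \<le> norm (x + ?t *\<^sub>R ?e)"
          using norm_triangle_ineq2[of x "- ?t *\<^sub>R ?e"] by simp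
        with False t(2) have "norm (x + ?t *\<^sub>R ?e) \<ge> 1" by linarith
        then have "s n x = 0"
          using zero[of x] zero[of "x + ?t *\<^sub>R ?e"] False by (simp add: s_def add.commute)
        then show ?thesis using False by simp
      qed
    qed
  qed
  then show ?thesis
    by (simp add: s_int LIMSEQ_const_iff)
qed

lemma partial_component:
  fixes F :: "plane \<Rightarrow> plane"
  assumes "F differentiable (at x)"
  shows "(\<lambda>x. F x $ j) differentiable (at x)" "partial i (\<lambda>x. F x $ j) x = partial i F x $ j"
proof -
  have "((\<lambda>x. F x $ j) has_derivative (\<lambda>h. frechet_derivative F (at x) h $ j)) (at x)"
    using assms unfolding frechet_derivative_works
    by (rule bounded_linear.has_derivative[OF bounded_linear_vec_nth])
  then show "(\<lambda>x. F x $ j) differentiable (at x)" "partial i (\<lambda>x. F x $ j) x = partial i F x $ j"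
    using partial_eq by (auto simp: differentiable_def partial_def)
qed

text \<open>Integration by parts: the product of \<open>f\<close> and the test function, extended by
  0, is C1 on the whole plane, so its partial derivative integrates to 0.\<close>

lemma C1_weak_partial_on:
  fixes f :: "plane \<Rightarrow> real"
  assumes "open V" "cball 0 1 \<subseteq> V" and f: "Ck_on 1 V f"
  shows "weak_partial_on unit_disk i f (partial i f)"
  unfolding weak_partial_on_def
proof (intro allI impI)
  fix \<phi> assume \<phi>: "test_function unit_disk \<phi>"
  define K where "K = closure {x. \<phi> x \<noteq> 0}"
  have K: "closed K" "K \<subseteq> unit_disk" "\<And>x. x \<notin> K \<Longrightarrow> \<phi> x = 0"
    using \<phi> closure_subset[of "{x. \<phi> x \<noteq> 0}"] unfolding K_def test_function_def
    by (blast intro: closed_closure)+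
  have "Ck_on 1 UNIV \<phi>" using \<phi> by (simp add: test_function_def)
  then have d\<phi>: "\<phi> differentiable (at x)" and c\<phi>: "continuous_on UNIV (partial i \<phi>)" for x
    by (simp_all add: differentiable_on_eq_differentiable_at)
  have df: "f differentiable (at x)" if "x \<in> V" for x
    using f that assms(1) by (simp add: differentiable_on_eq_differentiable_at)
  have cf: "continuous_on V (partial i f)" "continuous_on V f"
    using f by (simp_all add: differentiable_imp_continuous_on)
  have c\<phi>0: "continuous_on UNIV \<phi>"
    using d\<phi> by (simp add: continuous_on_eq_continuous_at differentiable_imp_continuous_within)
  have cint: "continuous_on (cball 0 1) (\<lambda>x. f x * partial i \<phi> x)"
    "continuous_on (cball 0 1) (\<lambda>x. partial i f x * \<phi> x)"
    by (intro continuous_intros continuous_on_subset[OF cf(1) assms(2)]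
        continuous_on_subset[OF cf(2) assms(2)] continuous_on_subset[OF c\<phi>] continuous_on_subset[OF c\<phi>0]; simp)+
  define \<psi> where "\<psi> x = (if x \<in> unit_disk then f x * \<phi> x else 0)" for x
  have in_D: "(\<psi> has_derivative (\<lambda>h. f x * frechet_derivative \<phi> (at x) h + frechet_derivative f (at x) h * \<phi> x)) (at x)"
    if x: "x \<in> unit_disk" for x
  proof -
    have "((\<lambda>x. f x * \<phi> x) has_derivative
        (\<lambda>h. f x * frechet_derivative \<phi> (at x) h + frechet_derivative f (at x) h * \<phi> x)) (at x)"
      using df[of x] d\<phi>[of x] subsetD[OF assms(2), of x] x unfolding frechet_derivative_works
      by (intro has_derivative_mult) auto
    then show ?thesis
      by (rule has_derivative_transform_within_open[OF _ open_ball x]) (simp add: \<psi>_def)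
  qed
  have off_K: "(\<psi> has_derivative (\<lambda>h. 0)) (at x)" if "x \<notin> K" for x
    by (rule has_derivative_transform_within_open[OF has_derivative_const[of 0] open_Compl[OF K(1)]])
       (use that K in \<open>auto simp: \<psi>_def\<close>)
  have p\<psi>: "partial i \<psi> x = f x * partial i \<phi> x + partial i f x * \<phi> x" if "x \<in> unit_disk" for x
    using partial_eq[OF in_D[OF that]] by (simp add: partial_def)
  have p\<psi>0: "partial i \<psi> x = 0" if "x \<notin> K" for x
    using partial_eq[OF off_K[OF that]] .
  \<comment> \<open>The disk and the complement of the support \<open>K\<close> are open and cover
    the plane; the product rule serves on the first, the zero function on the second.\<close>
  have "continuous_on (unit_disk \<union> - K) (partial i \<psi>)"
  proof (rule continuous_on_open_Un)
    have "continuous_on unit_disk (\<lambda>x. f x * partial i \<phi> x + partial i f x * \<phi> x)"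
      by (intro continuous_on_add continuous_on_subset[OF cint(1)] continuous_on_subset[OF cint(2)]) auto
    then show "continuous_on unit_disk (partial i \<psi>)"
      by (rule continuous_on_eq) (use p\<psi> in auto)
    show "continuous_on (- K) (partial i \<psi>)"
      by (rule continuous_on_eq[OF continuous_on_const[of _ 0]]) (use p\<psi>0 in auto)
  qed (use K in \<open>auto simp: open_Compl\<close>)
  moreover have "unit_disk \<union> - K = UNIV" using K(2) by blast
  ultimately have cont: "continuous_on UNIV (partial i \<psi>)" by simp
  have "(\<integral>x. partial i \<psi> x \<partial>lborel) = 0"
  proof (rule integral_partial_eq_0)
    show "\<psi> differentiable (at x)" for x
      using in_D[of x] off_K[of x] K(2) unfolding differentiable_def by blast
    show "\<psi> x = 0" if "norm x \<ge> 1" for x using that by (simp add: \<psi>_def)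
    show "continuous_on UNIV (partial i \<psi>)" by (rule cont)
  qed
  moreover have "partial i \<psi> \<in> borel_measurable lborel"
    using cont by (simp add: borel_measurable_continuous_onI)
  ultimately have "(\<integral>x. partial i \<psi> x \<partial>lebesgue) = 0"
    by (simp add: integral_completion)
  also have "partial i \<psi> = (\<lambda>x. indicator unit_disk x *\<^sub>R (f x * partial i \<phi> x + partial i f x * \<phi> x))"
    using p\<psi> p\<psi>0 K(2) by (force simp: fun_eq_iff indicator_def)
  finally have "(LINT x:unit_disk|lebesgue. f x * partial i \<phi> x + partial i f x * \<phi> x) = 0"
    by (simp add: set_lebesgue_integral_def)
  then show "(LINT x:unit_disk|lebesgue. f x * partial i \<phi> x) =
      - (LINT x:unit_disk|lebesgue. partial i f x * \<phi> x)"
    using set_integral_add(2)[OF continuous_on_cball_set_integrable[OF cint(1)]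
        continuous_on_cball_set_integrable[OF cint(2)]] by simp
qed

lemma C1_W12_on:
  fixes F :: "plane \<Rightarrow> plane"
  assumes "open V" "cball 0 1 \<subseteq> V" and F: "Ck_on 1 V F"
  shows "W12_on unit_disk F"
proof -
  have dF: "F differentiable (at x)" if "x \<in> V" for x
    using F that assms(1) by (simp add: differentiable_on_eq_differentiable_at)
  have cF: "continuous_on V F" "continuous_on V (partial i F)" for i
    using F by (simp_all add: differentiable_imp_continuous_on)
  have cp: "continuous_on V (partial i (\<lambda>x. F x $ j))" for i j
    using partial_component(2)[OF dF] continuous_on_component[OF cF(2)]
    by (simp cong: continuous_on_cong)
  have C1: "Ck_on 1 V (\<lambda>x. F x $ j)" for j
    using cp partial_component(1)[OF dF] by (simp add: differentiable_on_eq_differentiable_at assms(1))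
  show ?thesis
    unfolding W12_on_def
  proof (intro allI conjI exI)
    show "L2_on unit_disk (\<lambda>x. F x $ j)" for j
      by (intro continuous_on_cball_L2_on continuous_on_component continuous_on_subset[OF cF(1) assms(2)])
    show "L2_on unit_disk (partial i (\<lambda>x. F x $ j))" for i j
      by (intro continuous_on_cball_L2_on continuous_on_subset[OF cp assms(2)])
    show "weak_partial_on unit_disk i (\<lambda>x. F x $ j) (partial i (\<lambda>x. F x $ j))" for i j
      by (rule C1_weak_partial_on[OF assms(1,2) C1])
  qed
qed

section \<open>Inversion of the conformal map\<close>

text \<open>With no pole on the closed disk the map is holomorphic on an open set containing it.
  Continuity up to the circle then makes the map and its first partials square integrable.\<close>

lemma mob_disk_regular:
  assumes "\<And>y. norm y \<le> 1 \<Longrightarrow> mob a b c d (Some y) \<noteq> None"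
  defines "F \<equiv> (\<lambda>u. the (mob a b c d (Some u)))"
  shows "W12_on unit_disk F" "solves_laplace_on unit_disk F" "continuous_on (cball 0 1) F"
proof -
  define S where "S = {z. c * z + d \<noteq> 0}"
  define f where "f z = (a * z + b) / (c * z + d)" for z
  have "open S"
    unfolding S_def by (intro open_Collect_neq continuous_intros)
  have hol: "f holomorphic_on S"
    unfolding f_def S_def by (intro holomorphic_intros) auto
  note V = open_vimage_cx[OF \<open>open S\<close>]
  have FV: "F u = pl (f (cx u))" if "u \<in> cx -` S" for u
    using that by (simp add: F_def f_def S_def mob_def)
  have sub: "cball 0 1 \<subseteq> cx -` S"
    using assms(1) by (force simp: S_def mob_def split: if_splits)
  have C1: "Ck_on 1 (cx -` S) F"
    using Ck_on_holomorphic[OF hol \<open>open S\<close>] Ck_on_cong_open[OF V, of F "\<lambda>u. pl (f (cx u))"] FV by blast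
  show "W12_on unit_disk F"
    by (rule C1_W12_on[OF V sub C1])
  have "continuous_on (cx -` S) F"
    using C1 by (simp add: differentiable_imp_continuous_on)
  then show "continuous_on (cball 0 1) F"
    using sub by (rule continuous_on_subset)
  have "unit_disk \<subseteq> cx -` S" using sub ball_subset_cball by blast
  then show "solves_laplace_on unit_disk F"
    using solves_laplace_on_holomorphic[OF hol \<open>open S\<close> _ open_ball]
      solves_laplace_on_cong_open[of unit_disk F "\<lambda>u. pl (f (cx u))"] FV by blast
qed

text \<open>Continuity of the inverse is topological: a continuous map from a compact space to a
  Hausdorff space is closed, and preimages under the inverse are images under the map.\<close>

lemma conformal_mapping_mob:
  assumes "p * s - q * r \<noteq> 0" and conf: "conformal_mapping UNIV (mob p q r s)"
  shows "conformal_mapping UNIV (mob s (- q) (- r) p)"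
proof -
  have det: "s * p - (- q) * (- r) \<noteq> 0" using assms(1) by (simp add: mult.commute)
  have inv1: "mob s (- q) (- r) p (mob p q r s x) = x" for x
    using mob_inverse[OF assms(1)] .
  have inv2: "mob p q r s (mob s (- q) (- r) p x) = x" for x
    using mob_inverse[OF det] by simp
  have top: "topspace ext_top = UNIV"
    using option.exhaust by (auto simp: image_iff)
  have "Hausdorff_space ext_top"
    by (simp add: Hausdorff_space_Alexandroff_compactification locally_compact_space_euclidean)
  then have closed: "closed_map ext_top ext_top (mob p q r s)"
    using conf by (intro continuous_imp_closed_map) (auto simp: conformal_mapping_def)
  have "continuous_map ext_top ext_top (mob s (- q) (- r) p)"
    unfolding continuous_map_closedin
  proof (intro conjI allI impI)
    fix C assume "closedin ext_top C"
    then have "closedin ext_top (mob p q r s ` C)"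
      using closed by (simp add: closed_map_def)
    moreover have "{x \<in> topspace ext_top. mob s (- q) (- r) p x \<in> C} = mob p q r s ` C"
      unfolding top by (auto simp: inv1) (metis image_eqI inv2)
    ultimately show "closedin ext_top {x \<in> topspace ext_top. mob s (- q) (- r) p x \<in> C}"
      by simp
  qed (unfold top, simp)
  moreover have "inj (mob s (- q) (- r) p)"
    by (metis injI inv2)
  ultimately show ?thesis
    unfolding conformal_mapping_def using conformal_at_mob_in_charts[OF det] by simp
qed

lemma equiareal_id: "equiareal id"
proof -
  have "in_charts id id id = (\<lambda>u. u)" "in_charts Inv Inv id = (\<lambda>u. u)"
    by (simp_all add: in_charts_def fun_eq_iff)
  moreover have "det (grad (\<lambda>u. u) x) = 1" for x
    by (simp add: grad_def frechet_derivative_at[OF has_derivative_ident, symmetric] matrix_id_mat_1[unfolded id_def])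
  ultimately show ?thesis
    by (auto simp: equiareal_def plane_charts_def)
qed

theorem theorem2p9:
  fixes h :: "ext_plane \<Rightarrow> ext_plane" and \<Omega>\<^sub>0 :: "plane set"
  assumes "open \<Omega>\<^sub>0"
    and "\<And>x. x \<in> Some ` \<Omega>\<^sub>0 \<Longrightarrow> h x \<in> Some ` unit_disk"
    and "\<And>x. x \<notin> Some ` \<Omega>\<^sub>0 \<Longrightarrow> h x \<notin> Some ` unit_disk"
    and "conformal_mapping UNIV h"
    and "W12_split \<Omega>\<^sub>0 UNIV h"
    and "\<And>x. h (Some x) \<noteq> None \<Longrightarrow> det (grad (in_charts id id h) x) > 0"
  shows "\<exists>g. g = glue (g1 \<Omega>\<^sub>0 h) (g2 \<Omega>\<^sub>0 h) \<and>
           (\<forall>x. g (h x) = x) \<and>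
           conformal_mapping (range h) g \<and>
           W12_split unit_disk (range h) g \<and>
           solves_laplace_on unit_disk (g1 \<Omega>\<^sub>0 h) \<and>
           solves_laplace_on unit_disk (g2 \<Omega>\<^sub>0 h) \<and>
           determined_by_laplace (\<lambda>y. g (Some y)) (g1 \<Omega>\<^sub>0 h) \<and>
           determined_by_laplace (\<lambda>y. Inv (g (Some y))) (g2 \<Omega>\<^sub>0 h) \<and>
           equiareal (g \<circ> h)"
proof -
  obtain p q r s where det: "p * s - q * r \<noteq> 0" and h: "h = mob p q r s"
    using conformal_mapping_UNIV_imp_mob[OF assms(4,6)] by blast
  have det': "s * p - (- q) * (- r) \<noteq> 0" using det by (simp add: mult.commute)
  define g where "g = mob s (- q) (- r) p"
  have gh: "g (h x) = x" for x
    unfolding g_def h by (rule mob_inverse[OF det])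
  have hg: "h (g y) = y" for y
    unfolding g_def h using mob_inverse[OF det'] by simp
  have into: "x \<in> Some ` \<Omega>\<^sub>0 \<longleftrightarrow> h x \<in> Some ` unit_disk" for x
    using assms(2,3) by blast
  have hN: "h None \<notin> Some ` cball 0 1"
    by (rule W12_split_imp_inf_outside_cball[OF into assms(4,5)])
  have zero: "0 \<in> \<Omega>\<^sub>0"
    by (rule W12_split_imp_zero_mem[OF into assms(4,5)])
  have g_into: "g y \<in> Some ` \<Omega>\<^sub>0 \<longleftrightarrow> y \<in> Some ` unit_disk" for y
    using into[of "g y"] by (simp add: hg)
  have range: "range h = UNIV"
    by (metis hg surjI)

  have Inv_disk: "Inv (Some y) \<notin> Some ` unit_disk \<longleftrightarrow> norm y \<le> 1" for y
  proof (cases "y = 0")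
    case False
    then obtain z where z: "Inv (Some y) = Some z" "norm z = 1 / norm y"
      using norm_Inv by (metis Inv_eq_None_iff not_None_eq option.inject)
    with False show ?thesis
      by (auto simp: image_iff not_less divide_less_eq)
  qed auto

  \<comment> \<open>\<open>F1\<close> and \<open>F2\<close> are \<open>g\<close> in the two
    coordinates. Regularity is proved for these Moebius maps and carried over to \<open>g1\<close>
    and \<open>g2\<close>, which are tied to \<open>g\<close> only over the images of
    \<open>h1\<close> and \<open>h2\<close>.\<close>
  define F1 where "F1 u = the (g (Some u))" for u
  define F2 where "F2 u = the (Inv (g (Inv (Some u))))" for u
  have F1: "g (Some y) = Some (F1 y)" if "norm y \<le> 1" for y
  proof -
    have "g (Some y) \<noteq> None"
    proof
      assume "g (Some y) = None"
      then have "h None = Some y" using hg[of "Some y"] by simp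
      then show False using hN that by auto
    qed
    then show ?thesis by (auto simp: F1_def)
  qed
  have F2: "Inv (g (Inv (Some y))) = Some (F2 y)" if "norm y \<le> 1" for y
  proof -
    \<comment> \<open>A pole of \<open>F2\<close> would force Inv y = h 0. That image lies in the
      open disk because 0 is in \<open>\<Omega>\<^sub>0\<close>, whereas \<open>Inv (Some y)\<close>
      does not.\<close>
    have "g (Inv (Some y)) \<noteq> Some 0"
      using g_into[of "Inv (Some y)"] Inv_disk[of y] that zero by auto
    then have "Inv (g (Inv (Some y))) \<noteq> None" by simp
    then show ?thesis by (auto simp: F2_def)
  qed

  have F2_mob: "F2 u = the (mob (cnj p) (cnj (- r)) (cnj (- q)) (cnj s) (Some u))" for u
    unfolding F2_def g_def by (simp only: Inv_mob_Inv[OF det'])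
  have fin2: "mob (cnj p) (cnj (- r)) (cnj (- q)) (cnj s) (Some y) \<noteq> None" if "norm y \<le> 1" for y
    using F2[OF that] unfolding g_def Inv_mob_Inv[OF det'] by simp
  have reg1: "W12_on unit_disk F1" "solves_laplace_on unit_disk F1" "continuous_on (cball 0 1) F1"
    unfolding F1_def[abs_def] g_def
    by (rule mob_disk_regular; use F1 in \<open>simp add: g_def\<close>)+
  have reg2: "W12_on unit_disk F2" "solves_laplace_on unit_disk F2" "continuous_on (cball 0 1) F2"
    unfolding F2_mob[abs_def]
    by (rule mob_disk_regular; use fin2 in blast)+

  have g1_eq: "g1 \<Omega>\<^sub>0 h y = F1 y" if "y \<in> unit_disk" for y
    unfolding g1_def
  proof (rule inv_into_f_eq)
    show "inj_on (h1 h) \<Omega>\<^sub>0"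
    proof (rule inj_onI)
      fix u v assume "u \<in> \<Omega>\<^sub>0" "v \<in> \<Omega>\<^sub>0" and eq: "h1 h u = h1 h v"
      then have "h (Some u) \<in> Some ` unit_disk" "h (Some v) \<in> Some ` unit_disk"
        using into by auto
      then have "h (Some u) = h (Some v)"
        using eq by (auto simp: h1_def in_charts_def)
      then show "u = v" using gh by (metis option.inject)
    qed
    have y: "g (Some y) = Some (F1 y)" using F1 that by simp
    then show "F1 y \<in> \<Omega>\<^sub>0" using g_into[of "Some y"] that by auto
    show "h1 h (F1 y) = y"
      using hg[of "Some y"] y by (simp add: h1_def in_charts_def)
  qed
  \<comment> \<open>The closed disk is needed here: \<open>glue\<close> reads the unit circle
    through \<open>g2\<close>.\<close>
  have g2_eq: "g2 \<Omega>\<^sub>0 h y = F2 y" if "norm y \<le> 1" for y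
    unfolding g2_def
  proof (rule inv_into_f_eq)
    show "inj_on (h2 h) (Omega_hat \<Omega>\<^sub>0)"
    proof (rule inj_onI)
      fix u v assume "u \<in> Omega_hat \<Omega>\<^sub>0" "v \<in> Omega_hat \<Omega>\<^sub>0" and eq: "h2 h u = h2 h v"
      \<comment> \<open>Off \<open>\<Omega>\<^sub>0\<close> the values of \<open>h\<close> avoid the
        disk and in particular 0, so both \<open>Inv\<close> values are finite and
        \<open>the\<close> loses no information.\<close>
      then have "h (Inv (Some u)) \<noteq> Some 0" "h (Inv (Some v)) \<noteq> Some 0"
        using into by (auto simp: Omega_hat_def)
      then have "Inv (h (Inv (Some u))) \<noteq> None" "Inv (h (Inv (Some v))) \<noteq> None"
        by simp_all
      then have "Inv (h (Inv (Some u))) = Inv (h (Inv (Some v)))"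
        using eq by (intro option.expand) (auto simp: h2_def in_charts_def)
      then have "Inv (Some u) = Inv (Some v)" using gh by (metis Inv_inj)
      then show "u = v" by simp
    qed
    have y: "Inv (Some (F2 y)) = g (Inv (Some y))"
      using F2[OF that] by (metis Inv_Inv)
    then show "F2 y \<in> Omega_hat \<Omega>\<^sub>0"
      using g_into[of "Inv (Some y)"] Inv_disk[of y] that by (simp add: Omega_hat_def)
    show "h2 h (F2 y) = y"
      by (simp add: h2_def in_charts_def y hg)
  qed

  have "g y = glue (g1 \<Omega>\<^sub>0 h) (g2 \<Omega>\<^sub>0 h) y" for y
  proof (cases "y \<in> Some ` unit_disk")
    case True
    then show ?thesis
      using F1 g1_eq by (auto simp: glue_def)
  next
    case False
    then have "Inv y \<noteq> None" by auto
    then obtain z where z: "Inv y = Some z" by blast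
    then have y: "y = Inv (Some z)" by (metis Inv_Inv)
    then have "norm z \<le> 1" using False Inv_disk by simp
    then show ?thesis
      using False F2[of z] g2_eq[of z] z by (simp add: glue_def flip: y) (metis Inv_Inv)
  qed
  then have g: "g = glue (g1 \<Omega>\<^sub>0 h) (g2 \<Omega>\<^sub>0 h)" by blast

  have conf: "conformal_mapping (range h) g"
    unfolding range g_def using conformal_mapping_mob[OF det] assms(4) h by simp

  have W: "W12_split unit_disk (range h) g"
  proof -
    \<comment> \<open>In the inverted coordinate the complement of the open disk is the closed disk,
      so the interior taken in \<open>W12_split\<close> is the open disk again.\<close>
    have "{u. Inv (Some u) \<in> UNIV - Some ` unit_disk} = cball 0 1"
      using Inv_disk by auto
    moreover have "in_charts id id g = F1" "in_charts Inv Inv g = F2"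
      by (auto simp: in_charts_def F1_def F2_def)
    moreover have "{u \<in> unit_disk. Some u \<in> UNIV} = unit_disk" by auto
    ultimately show ?thesis
      unfolding W12_split_def range by (simp only: interior_cball reg1(1) reg2(1) simp_thms)
  qed

  have lap: "solves_laplace_on unit_disk (g1 \<Omega>\<^sub>0 h)" "solves_laplace_on unit_disk (g2 \<Omega>\<^sub>0 h)"
    using solves_laplace_on_cong_open[OF open_ball, of 0 1 "g1 \<Omega>\<^sub>0 h" F1] g1_eq reg1(2)
      solves_laplace_on_cong_open[OF open_ball, of 0 1 "g2 \<Omega>\<^sub>0 h" F2] g2_eq reg2(2) by auto

  have det1: "determined_by_laplace (\<lambda>y. g (Some y)) (g1 \<Omega>\<^sub>0 h)"
  proof (rule dirichlet_solution_imp_determined)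
    show "dirichlet_solution (\<lambda>y. g (Some y)) F1"
      unfolding dirichlet_solution_def using reg1 F1 by auto
  qed (use g1_eq in auto)

  have det2: "determined_by_laplace (\<lambda>y. Inv (g (Some y))) (g2 \<Omega>\<^sub>0 h)"
  proof (rule dirichlet_solution_imp_determined)
    \<comment> \<open>\<open>Inv\<close> fixes the unit circle pointwise, so y and its inverted
      coordinate agree in the boundary condition.\<close>
    have "Some (F2 y) = Inv (g (Some y))" if "norm y = 1" for y
    proof -
      have "Inv (Some y) = Some y" using that by (auto simp: Inv.simps(2))
      then show ?thesis using F2[of y] that by simp
    qed
    then show "dirichlet_solution (\<lambda>y. Inv (g (Some y))) F2"
      unfolding dirichlet_solution_def using reg2 by auto
  qed (use g2_eq in auto)

  have "g \<circ> h = id" using gh by auto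
  then have "equiareal (g \<circ> h)" using equiareal_id by simp
  with g gh conf W lap det1 det2 show ?thesis by blast
qed

end
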